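(* Let $q$ be a prime power. Every intersecting family in $\mathrm{PGL}(2,q)$ of size at least $\frac1{\sqrt2}q^2+2\sqrt2\,q+8$ lies in a coset of the stabiliser of some point of $\mathrm{PG}(1,q)$.
   Context: An intersecting family in $\mathrm{PGL}(2,q)$ is a set $\mathcal F\subseteq\mathrm{PGL}(2,q)$ such that for all $M,N\in\mathcal F$ there exists a point $P$ of the projective line $\mathrm{PG}(1,q)$ with $MP=NP$. *)

theory Defs
  imports "HOL-Analysis.Analysis" "HOL-Algebra.Group_Action"
begin

definition GL2 :: "('a::field^2^2) monoid" where
  "GL2 = \<lparr>carrier = {A. invertible A}, mult = (**), one = mat 1\<rparr>"

definition scalar_matrices :: "('a::field^2^2) set" where
  "scalar_matrices = {mat c | c. c \<noteq> 0}"

definition PGL2 :: "('a::field^2^2) set monoid" where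
  "PGL2 = GL2 Mod scalar_matrices"

definition PG1 :: "('a::field^2) set set" where
  "PG1 = {P. vec.subspace P \<and> vec.dim P = 1}"

(* An element of PGL2 is a class M of proportional matrices. All of them map the line P onto the
   same line, so the union over the class is the image of P under any representative;
   see PGL2_action_rep. *)
definition PGL2_action :: "('a::field^2^2) set \<Rightarrow> ('a^2) set \<Rightarrow> ('a^2) set" where
  "PGL2_action M P = {A *v x | A x. A \<in> M \<and> x \<in> P}"

definition intersecting_family :: "('a::field^2^2) set set \<Rightarrow> bool" where
  "intersecting_family F \<longleftrightarrow>
     F \<subseteq> carrier PGL2 \<and> (\<forall>M\<in>F. \<forall>N\<in>F. \<exists>P\<in>PG1. PGL2_action M P = PGL2_action N P)"

lemma mat_matrix_mul_vec:
  fixes A :: "'a::field^2^2"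
  shows "(mat c ** A) *v x = c *s (A *v x)"
proof -
  have "mat c *v y = c *s y" for y :: "'a^2"
    by (simp add: vec_eq_iff matrix_vector_mult_def mat_def sum_2 forall_2)
  thus ?thesis by (simp flip: matrix_vector_mul_assoc)
qed

lemma mat_mult_commute:
  fixes A :: "'a::field^2^2"
  shows "mat c ** A = A ** mat c"
  by (simp add: vec_eq_iff matrix_matrix_mult_def mat_def sum_2 forall_2)

lemma mat_mult_mat: "mat c ** mat d = (mat (c * d) :: 'a::field^2^2)"
  by (simp add: vec_eq_iff matrix_matrix_mult_def mat_def sum_2 forall_2)

lemma group_GL2: "group (GL2 :: ('a::field^2^2) monoid)"
proof (rule groupI)
  fix A :: "'a^2^2" assume "A \<in> carrier GL2"
  then obtain B where "A ** B = mat 1" "B ** A = mat 1"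
    by (auto simp: GL2_def invertible_def)
  thus "\<exists>B\<in>carrier GL2. B \<otimes>\<^bsub>GL2\<^esub> A = \<one>\<^bsub>GL2\<^esub>"
    by (auto simp: GL2_def invertible_def)
next
  show "\<one>\<^bsub>GL2\<^esub> \<in> carrier (GL2 :: ('a^2^2) monoid)"
    by (auto simp: GL2_def invertible_def)
qed (auto simp: GL2_def invertible_mult matrix_mul_assoc)

lemma normal_scalar_matrices:
  "normal (scalar_matrices :: ('a::field^2^2) set) GL2"
proof -
  interpret group "GL2 :: ('a^2^2) monoid" by (rule group_GL2)
  have inv_mat: "invertible (mat c :: 'a^2^2)" if "c \<noteq> 0" for c
    unfolding invertible_def using that
    by (intro exI[of _ "mat (inverse c)"]) (simp add: mat_mult_mat)
  have "subgroup scalar_matrices (GL2 :: ('a^2^2) monoid)"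
  proof (rule subgroupI)
    fix A :: "'a^2^2" assume "A \<in> scalar_matrices"
    then obtain c where c: "c \<noteq> 0" "A = mat c" by (auto simp: scalar_matrices_def)
    have "inv\<^bsub>GL2\<^esub> A = mat (inverse c)"
      using c by (intro inv_equality) (auto simp: GL2_def mat_mult_mat inv_mat)
    thus "inv\<^bsub>GL2\<^esub> A \<in> scalar_matrices"
      using c by (auto simp: scalar_matrices_def)
  next
    fix A B :: "'a^2^2" assume "A \<in> scalar_matrices" "B \<in> scalar_matrices"
    thus "A \<otimes>\<^bsub>GL2\<^esub> B \<in> scalar_matrices"
      by (force simp: scalar_matrices_def GL2_def mat_mult_mat)
  qed (auto simp: scalar_matrices_def GL2_def inv_mat intro!: exI[of _ "1::'a"])
  moreover have "scalar_matrices #>\<^bsub>GL2\<^esub> A = A <#\<^bsub>GL2\<^esub> scalar_matrices" for A :: "'a^2^2"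
    unfolding r_coset_def l_coset_def
    by (auto simp: GL2_def scalar_matrices_def mat_mult_commute)
  ultimately show ?thesis by (intro normalI) auto
qed

lemma group_PGL2: "group (PGL2 :: ('a::field^2^2) set monoid)"
  unfolding PGL2_def by (rule normal.factorgroup_is_group[OF normal_scalar_matrices])

lemma PGL2_action_rep:
  fixes A :: "'a::field^2^2"
  assumes "vec.subspace P"
  shows "PGL2_action (scalar_matrices #>\<^bsub>GL2\<^esub> A) P = (*v) A ` P"
proof -
  have "(mat c ** A) *v x \<in> (*v) A ` P" if "x \<in> P" for c x
    using vec.subspace_scale[OF assms that, of c]
    by (auto simp: mat_matrix_mul_vec simp flip: vec.scale)
  moreover have "\<exists>c x. c \<noteq> 0 \<and> A *v y = (mat c ** A) *v x \<and> x \<in> P" if "y \<in> P" for y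
    using that by (intro exI[of _ 1] exI[of _ y]) simp
  ultimately show ?thesis
    unfolding PGL2_action_def r_coset_def scalar_matrices_def
    by (fastforce simp: GL2_def)
qed

end

theory Submission
  imports Defs
begin

text \<open>
  Let \<open>n = |F|\<close> and let \<open>F\<^bsub>PQ\<^esub>\<close> be the members of \<open>F\<close> that map \<open>P\<close> to \<open>Q\<close>. Two distinct members agree in two
  points, or in exactly one point; call them tangent in the latter case. A second moment computation
  in \<open>PGL2\<close> shows that \<open>F\<close> has at most \<open>2 n\<^sup>2 / q + q n\<close> ordered pairs of equal or tangent members. So the
  sum of all \<open>|F\<^bsub>PQ\<^esub>|\<^sup>2\<close>, which counts agreements, is about \<open>2 n\<^sup>2\<close>, and since the \<open>|F\<^bsub>PQ\<^esub>|\<close> add up to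
  \<open>(q + 1) n\<close>, some \<open>m = |F\<^bsub>PQ\<^esub>|\<close> is at least about \<open>2 n / q\<close>.

  In an affine chart with \<open>P = Q = \<infinity>\<close>, the elements mapping \<open>P\<close> to \<open>Q\<close> are non-constant affine maps, and
  every other element agrees nowhere with exactly half of them. Two affine maps are simultaneously
  missed by about a quarter of the other elements, so a second moment computation bounds
  cross-intersecting sets: \<open>m (n - m) \<le> (q - 1) (q\<^sup>2 + m)\<close>. If \<open>m \<ge> 2 n / q\<close> and \<open>n\<close> exceeds
  \<open>q\<^sup>2 / sqrt 2\<close>, this leaves only values of \<open>m\<close> above \<open>q (q - 1) / 2\<close>, and then an element outside of
  \<open>F\<^bsub>PQ\<^esub>\<close> could not agree with all of \<open>F\<^bsub>PQ\<^esub>\<close>.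
\<close>

section \<open>Quadratics without roots over a finite field\<close>

definition rootless :: "'a::field \<Rightarrow> 'a \<Rightarrow> 'a \<Rightarrow> bool" where
  "rootless a b c \<longleftrightarrow> (\<forall>x. a * x\<^sup>2 + b * x + c \<noteq> 0)"

text \<open>The fibres of \<open>g\<close> on \<open>X\<close> are the sets \<open>{y, s y}\<close>.
  Each fibre accounts for 2 on the right: two elements, or one element that is counted again as a
  fixed point of \<open>s\<close>.\<close>

lemma card_two_point_fibres:
  assumes "finite X" and invol: "\<And>y y'. y \<in> X \<Longrightarrow> y' \<in> X \<Longrightarrow> g y = g y' \<longleftrightarrow> y' = y \<or> y' = s y"
    and closed: "\<And>y. y \<in> X \<Longrightarrow> s y \<in> X"
  shows "2 * card (g ` X) = card X + card {y \<in> X. s y = y}"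
proof -
  let ?fib = "\<lambda>u. {y \<in> X. g y = u}"
  have split: "card A = (\<Sum>u\<in>g ` X. card (?fib u \<inter> A))" if "A \<subseteq> X" for A
  proof -
    have "A = (\<Union>u\<in>g ` X. ?fib u \<inter> A)" using that by auto
    then have "card A = card (\<Union>u\<in>g ` X. ?fib u \<inter> A)" by simp
    also have "\<dots> = (\<Sum>u\<in>g ` X. card (?fib u \<inter> A))"
      using assms(1) by (intro card_UN_disjoint) auto
    finally show ?thesis .
  qed
  have "2 = card (?fib u \<inter> X) + card (?fib u \<inter> {y \<in> X. s y = y})" if "u \<in> g ` X" for u
  proof -
    obtain y where y: "y \<in> X" "u = g y" using \<open>u \<in> g ` X\<close> by blast
    have fib: "?fib u \<inter> X = {y, s y}"
    proof -
      have "g z = g y \<longleftrightarrow> z = y \<or> z = s y" if "z \<in> X" for z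
        using invol[OF y(1) that] by auto
      then show ?thesis using y closed by auto
    qed
    have inv2: "s (s y) = y"
      using invol[OF y(1) closed[OF y(1)]] invol[OF closed[OF y(1)] y(1)]
      by (metis y(1) closed invol)
    have "?fib u \<inter> {y \<in> X. s y = y} = (if s y = y then {y} else {})"
      using fib inv2 by auto
    then show ?thesis using fib by simp
  qed
  then have "2 * card (g ` X) =
      (\<Sum>u\<in>g ` X. card (?fib u \<inter> X) + card (?fib u \<inter> {y \<in> X. s y = y}))"
    by simp
  also have "\<dots> = card X + card {y \<in> X. s y = y}"
    unfolding sum.distrib using split[of X] split[of "{y \<in> X. s y = y}"] by simp
  finally show ?thesis .
qed

text \<open>Since \<open>k\<close> is nonzero, \<open>0\<close> is never a root, and a nonzero
  \<open>y\<close> is a root exactly when \<open>u = - (a * y + k / y)\<close>. The two roots have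
  product \<open>k / a\<close>, so this value determines \<open>y\<close> up to the involution
  taking \<open>y\<close> to \<open>k / (a * y)\<close>.\<close>

lemma card_rootless_linear_coeff:
  fixes a k :: "'a::{field,finite}"
  assumes "a \<noteq> 0" "k \<noteq> 0"
  shows "2 * card {u. rootless a u k} + card {y. a * y\<^sup>2 = k} = CARD('a) + 1"
proof -
  let ?X = "UNIV - {0::'a}" and ?g = "\<lambda>y. - (a * y + k / y)"
  have "2 * card (?g ` ?X) = card ?X + card {y \<in> ?X. k / (a * y) = y}"
  proof (rule card_two_point_fibres)
    fix y y' assume "y \<in> ?X" "y' \<in> ?X"
    then have nz: "y \<noteq> 0" "y' \<noteq> 0" by auto
    have "?g y = ?g y' \<longleftrightarrow> a * y + k / y = a * y' + k / y'"
      by (simp only: neg_equal_iff_equal)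
    also have "\<dots> \<longleftrightarrow> (a * y + k / y) * (y * y') = (a * y' + k / y') * (y * y')"
      using nz by simp
    also have "\<dots> \<longleftrightarrow> (y' - y) * (k - a * y * y') = 0"
    proof -
      have "(a * y + k / y) * (y * y') - (a * y' + k / y') * (y * y') = (y' - y) * (k - a * y * y')"
        using nz by (simp add: field_simps)
      then show ?thesis by (metis eq_iff_diff_eq_0)
    qed
    also have "\<dots> \<longleftrightarrow> y' = y \<or> y' = k / (a * y)"
    proof -
      have "k - a * y * y' = 0 \<longleftrightarrow> y' = k / (a * y)"
        using nz assms by (auto simp: field_simps)
      then show ?thesis by simp
    qed
    finally show "?g y = ?g y' \<longleftrightarrow> y' = y \<or> y' = k / (a * y)" .
  qed (use assms in auto)
  also have "{y \<in> ?X. k / (a * y) = y} = {y. a * y\<^sup>2 = k}"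
    using assms by (auto simp: field_simps power2_eq_square)
  finally have image: "2 * card (?g ` ?X) = card ?X + card {y. a * y\<^sup>2 = k}" .
  have rootless: "{u. rootless a u k} = UNIV - ?g ` ?X"
  proof -
    have "u \<in> ?g ` ?X \<longleftrightarrow> \<not> rootless a u k" for u
    proof
      assume "u \<in> ?g ` ?X"
      then obtain y where y: "y \<noteq> 0" "u = ?g y" by blast
      have "a * y\<^sup>2 + u * y + k = 0"
        using y by (simp add: field_simps power2_eq_square)
      then show "\<not> rootless a u k" unfolding rootless_def by blast
    next
      assume "\<not> rootless a u k"
      then obtain y where y: "a * y\<^sup>2 + u * y + k = 0" unfolding rootless_def by blast
      have "y \<noteq> 0" using y assms by auto
      moreover have "u = ?g y"
      proof -
        have "(?g y) * y = - (a * y\<^sup>2 + k)"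
          using \<open>y \<noteq> 0\<close> by (simp add: field_simps power2_eq_square)
        moreover have "u * y = - (a * y\<^sup>2 + k)"
          using y by (simp add: eq_neg_iff_add_eq_0 algebra_simps)
        ultimately have "u * y = (?g y) * y" by simp
        then show ?thesis using \<open>y \<noteq> 0\<close> by simp
      qed
      ultimately show "u \<in> ?g ` ?X" by blast
    qed
    then show ?thesis by auto
  qed
  have "card {u. rootless a u k} = CARD('a) - card (?g ` ?X)"
    unfolding rootless by (rule card_Diff_subset) auto
  moreover have "card (?g ` ?X) \<le> CARD('a)" by (rule card_mono) auto
  moreover have "card ?X = CARD('a) - 1" "CARD('a) > 0" by (simp_all add: card_Diff_subset)
  ultimately show ?thesis using image by linarith
qed

lemma rootless_const_nonzero: "rootless a u k \<Longrightarrow> k \<noteq> 0"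
  unfolding rootless_def by (auto dest: spec[of _ 0])

lemma sum_fibre_indicators:
  fixes f :: "'b::finite \<Rightarrow> 'c"
  assumes "finite K"
  shows "(\<Sum>k\<in>K. card {y. f y = k}) = card {y. f y \<in> K}"
proof -
  have "{y. f y \<in> K} = (\<Union>k\<in>K. {y. f y = k})" by auto
  then have "card {y. f y \<in> K} = card (\<Union>k\<in>K. {y. f y = k})" by simp
  also have "\<dots> = (\<Sum>k\<in>K. card {y. f y = k})"
    using assms by (intro card_UN_disjoint) auto
  finally show ?thesis by simp
qed

lemma real_card_nonzero: "real (card (UNIV - {0::'a::{field,finite}})) = real CARD('a) - 1"
  by (simp add: card_Diff_subset of_nat_diff Suc_leI)

lemma sum_card_scaled_square_const:
  fixes a :: "'a::{field,finite}"
  assumes "a \<noteq> 0"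
  shows "(\<Sum>k\<in>UNIV - {0}. card {y. a * y\<^sup>2 = k}) = card (UNIV - {0::'a})"
proof -
  have "{y. a * y\<^sup>2 \<in> UNIV - {0}} = UNIV - {0}" using assms by auto
  then show ?thesis by (subst sum_fibre_indicators) simp_all
qed

lemma sum_card_scaled_square_lead:
  fixes k :: "'a::{field,finite}"
  assumes "k \<noteq> 0"
  shows "(\<Sum>a\<in>UNIV - {0}. card {y. a * y\<^sup>2 = k}) = card (UNIV - {0::'a})"
proof -
  have "{y. a * y\<^sup>2 = k} = {y. y \<noteq> 0 \<and> k / y\<^sup>2 = a}" for a
    using assms by (auto simp: field_simps)
  \<comment> \<open>The default at \<open>y = 0\<close> is harmless: only fibres over nonzero
    \<open>a\<close> are summed.\<close>
  then have "card {y. a * y\<^sup>2 = k} = card {y. (if y = 0 then 0 else k / y\<^sup>2) = a}" if "a \<noteq> 0" for a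
    using that by (intro arg_cong[where f=card]) auto
  then have "(\<Sum>a\<in>UNIV - {0}. card {y. a * y\<^sup>2 = k})
      = (\<Sum>a\<in>UNIV - {0}. card {y. (if y = 0 then 0 else k / y\<^sup>2) = a})" by simp
  also have "\<dots> = card {y. (if y = 0 then 0 else k / y\<^sup>2) \<in> UNIV - {0}}"
    by (rule sum_fibre_indicators) simp
  also have "\<dots> = card (UNIV - {0::'a})"
    using assms by (intro arg_cong[where f=card]) auto
  finally show ?thesis .
qed

lemma card_scaled_square_le_2:
  fixes a k :: "'a::field"
  assumes "a \<noteq> 0"
  shows "card {y. a * y\<^sup>2 = k} \<le> 2"
proof (cases "{y. a * y\<^sup>2 = k} = {}")
  case False
  then obtain y where "a * y\<^sup>2 = k" by blast
  then have "{y. a * y\<^sup>2 = k} \<subseteq> {y, -y}" using assms by (auto simp: power2_eq_iff)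
  then have "card {y. a * y\<^sup>2 = k} \<le> card {y, -y}" by (rule card_mono[rotated]) simp
  also have "\<dots> \<le> 2" by (simp add: card_insert_if)
  finally show ?thesis .
qed simp

lemma real_card_rootless_linear_coeff:
  fixes a k :: "'a::{field,finite}"
  assumes "a \<noteq> 0"
  shows "real (card {u. rootless a u k}) =
    (if k = 0 then 0 else (real CARD('a) + 1 - real (card {y. a * y\<^sup>2 = k})) / 2)"
proof (cases "k = 0")
  case True
  then have "{u. rootless a u k} = {}" using rootless_const_nonzero by blast
  with True show ?thesis by simp
next
  case False
  then have "real (2 * card {u. rootless a u k} + card {y. a * y\<^sup>2 = k}) = real (CARD('a) + 1)"
    using card_rootless_linear_coeff[OF assms False] by simp
  with False show ?thesis by simp
qed

text \<open>The correction terms \<open>card {y. a * y\<^sup>2 = k}\<close> add up to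
  \<open>q - 1\<close>, because every nonzero \<open>y\<close> belongs to exactly one nonzero
  \<open>k\<close>.\<close>

lemma sum_card_rootless:
  fixes a :: "'a::{field,finite}"
  assumes "a \<noteq> 0"
  shows "(\<Sum>k\<in>UNIV. real (card {u. rootless a u k})) = real CARD('a) * (real CARD('a) - 1) / 2"
proof -
  let ?q = "real CARD('a)"
  have "(\<Sum>k\<in>UNIV. real (card {u. rootless a u k}))
      = (\<Sum>k\<in>UNIV - {0}. (?q + 1 - real (card {y. a * y\<^sup>2 = k})) / 2)"
    by (rule sum.mono_neutral_cong_right) (auto simp: real_card_rootless_linear_coeff[OF assms])
  also have "\<dots> = (card (UNIV - {0::'a}) * (?q + 1) - (\<Sum>k\<in>UNIV - {0}. real (card {y. a * y\<^sup>2 = k}))) / 2"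
    by (simp add: sum_subtractf flip: sum_divide_distrib)
  also have "\<dots> = ((?q - 1) * (?q + 1) - (?q - 1)) / 2"
    using sum_card_scaled_square_const[OF assms] real_card_nonzero[where 'a='a]
    by (metis of_nat_sum)
  finally show ?thesis by (simp add: algebra_simps)
qed

text \<open>Only the product of the two correction terms is estimated, by bounding one factor by 2.
  The result exceeds \<open>q\<^sup>2 * (q - 1) / 4\<close> by just
  \<open>(q - 1) / 4\<close>.\<close>

lemma sum_card_rootless_mult_le:
  fixes a b :: "'a::{field,finite}"
  assumes "a \<noteq> 0" "b \<noteq> 0"
  shows "(\<Sum>k\<in>UNIV. real (card {u. rootless a u k}) * real (card {u. rootless b u k}))
     \<le> (real CARD('a) - 1) * ((real CARD('a))\<^sup>2 + 1) / 4"
proof -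
  let ?q = "real CARD('a)" and ?e = "\<lambda>a k. real (card {y::'a. a * y\<^sup>2 = k})" and ?N = "UNIV - {0::'a}"
  have e: "(\<Sum>k\<in>?N. ?e c k) = ?q - 1" if "c \<noteq> 0" for c
    using sum_card_scaled_square_const[OF that] real_card_nonzero[where 'a='a] by (metis of_nat_sum)
  have "(\<Sum>k\<in>UNIV. real (card {u. rootless a u k}) * real (card {u. rootless b u k}))
      = (\<Sum>k\<in>?N. (?q + 1 - ?e a k) / 2 * ((?q + 1 - ?e b k) / 2))"
    by (rule sum.mono_neutral_cong_right)
       (auto simp: real_card_rootless_linear_coeff[OF assms(1)] real_card_rootless_linear_coeff[OF assms(2)])
  also have "\<dots> \<le> (\<Sum>k\<in>?N. (?q + 1)\<^sup>2 / 4 - (?q + 1) / 4 * ?e a k - (?q + 1) / 4 * ?e b k + ?e b k / 2)"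
  proof (rule sum_mono)
    fix k
    have "?e a k \<le> 2" using card_scaled_square_le_2[OF assms(1), of k] by linarith
    then have "?e a k * ?e b k \<le> 2 * ?e b k" by (rule mult_right_mono) simp
    then show "(?q + 1 - ?e a k) / 2 * ((?q + 1 - ?e b k) / 2)
        \<le> (?q + 1)\<^sup>2 / 4 - (?q + 1) / 4 * ?e a k - (?q + 1) / 4 * ?e b k + ?e b k / 2"
      by (simp add: field_simps power2_eq_square)
  qed
  also have "\<dots> = (?q - 1) * ((?q + 1)\<^sup>2 / 4) - (?q + 1) / 4 * (\<Sum>k\<in>?N. ?e a k)
      - (?q + 1) / 4 * (\<Sum>k\<in>?N. ?e b k) + (\<Sum>k\<in>?N. ?e b k) / 2"
    by (simp only: sum.distrib sum_subtractf sum_distrib_left sum_divide_distrib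
        sum_constant real_card_nonzero)
  also have "\<dots> = (?q - 1) * (?q\<^sup>2 + 1) / 4"
    by (simp only: e[OF assms(1)] e[OF assms(2)]) (simp add: field_simps power2_eq_square)
  finally show ?thesis .
qed

text \<open>The points \<open>x\<close> and \<open>- w / a - x\<close> give
  \<open>a * x\<^sup>2 + w * x\<close> the same value and no third point does, so at least half of
  all \<open>k\<close> admit a root.\<close>

lemma card_rootless_const_le:
  fixes a w :: "'a::{field,finite}"
  assumes "a \<noteq> 0"
  shows "2 * card {k. rootless a w k} \<le> CARD('a)"
proof -
  let ?g = "\<lambda>x. - (a * x\<^sup>2 + w * x)"
  have "2 * card (range ?g) = CARD('a) + card {y. - w / a - y = y}"
  proof (subst card_two_point_fibres[where s="\<lambda>y. - w / a - y"])
    fix y y' :: 'a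
    have "?g y - ?g y' = (y' - y) * (a * (y' + y) + w)"
      by (simp add: power2_eq_square algebra_simps)
    then have "?g y = ?g y' \<longleftrightarrow> (y' - y) * (a * (y' + y) + w) = 0"
      by (metis eq_iff_diff_eq_0)
    also have "\<dots> \<longleftrightarrow> y' = y \<or> y' = - w / a - y"
    proof -
      have "a * (y' + y) + w = 0 \<longleftrightarrow> y' = - w / a - y"
        using assms by (auto simp: field_simps eq_neg_iff_add_eq_0)
      then show ?thesis by simp
    qed
    finally show "?g y = ?g y' \<longleftrightarrow> y' = y \<or> y' = - w / a - y" .
  qed simp_all
  moreover have "{k. rootless a w k} = UNIV - range ?g"
  proof -
    have "k = ?g x \<longleftrightarrow> a * x\<^sup>2 + w * x + k = 0" for k x
      by (metis eq_neg_iff_add_eq_0 add.commute)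
    then show ?thesis unfolding rootless_def by blast
  qed
  moreover have "card (UNIV - range ?g) = CARD('a) - card (range ?g)"
    by (rule card_Diff_subset) auto
  ultimately show ?thesis by simp
qed

section \<open>Affine maps and the elements missing them\<close>

lemma card_of_bool_sum: "finite A \<Longrightarrow> (\<Sum>x\<in>A. of_bool (P x) :: real) = card {x \<in> A. P x}"
  by (simp add: Int_def)

text \<open>Let \<open>n D\<close> be the number of elements of \<open>S\<close> related to
  \<open>D\<close>. Its mean over \<Omega> is half of \<open>card S\<close>, and \<open>pair\<close>
  bounds its second moment. Each element of \<open>T\<close> has \<open>n D = 0\<close> and so
  contributes \<open>(card S / 2)\<^sup>2\<close> to the sum of squared deviations.\<close>

lemma second_moment_bound:
  fixes R :: "'a \<Rightarrow> 'b \<Rightarrow> bool" and c :: real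
  assumes fin: "finite \<Omega>" "finite S" and "S \<noteq> {}"
    and half: "\<And>l. l \<in> S \<Longrightarrow> 2 * real (card {D \<in> \<Omega>. R l D}) = real (card \<Omega>)"
    and pair: "\<And>l l'. l \<in> S \<Longrightarrow> l' \<in> S \<Longrightarrow> l \<noteq> l' \<Longrightarrow> real (card {D \<in> \<Omega>. R l D \<and> R l' D}) \<le> c"
    and T: "T \<subseteq> \<Omega>" "\<And>l D. l \<in> S \<Longrightarrow> D \<in> T \<Longrightarrow> \<not> R l D"
  shows "real (card T) * real (card S)
    \<le> 2 * real (card \<Omega>) + 4 * (real (card S) - 1) * c - real (card S) * real (card \<Omega>)"
proof -
  let ?s = "real (card S)" and ?w = "real (card \<Omega>)"
  define n where "n D = (\<Sum>l\<in>S. of_bool (R l D) :: real)" for D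
  have "(\<Sum>D\<in>\<Omega>. n D) = (\<Sum>l\<in>S. real (card {D \<in> \<Omega>. R l D}))"
    unfolding n_def using fin by (subst sum.swap) (simp add: card_of_bool_sum del: sum_of_bool_eq)
  also have "\<dots> = (\<Sum>l\<in>S. ?w / 2)"
    using half by (intro sum.cong) (auto simp: field_simps)
  finally have first: "(\<Sum>D\<in>\<Omega>. n D) = ?s * ?w / 2" by simp
  have "(\<Sum>D\<in>\<Omega>. (n D)\<^sup>2) = (\<Sum>D\<in>\<Omega>. \<Sum>l\<in>S. \<Sum>l'\<in>S. of_bool (R l D \<and> R l' D))"
    unfolding n_def by (simp add: power2_eq_square sum_product of_bool_conj del: sum_of_bool_eq)
  also have "\<dots> = (\<Sum>l\<in>S. \<Sum>D\<in>\<Omega>. \<Sum>l'\<in>S. of_bool (R l D \<and> R l' D))"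
    by (rule sum.swap)
  also have "\<dots> = (\<Sum>l\<in>S. \<Sum>l'\<in>S. \<Sum>D\<in>\<Omega>. of_bool (R l D \<and> R l' D))"
    by (intro sum.cong refl sum.swap)
  also have "\<dots> = (\<Sum>l\<in>S. \<Sum>l'\<in>S. real (card {D \<in> \<Omega>. R l D \<and> R l' D}))"
    using fin by (simp only: card_of_bool_sum)
  also have "\<dots> \<le> (\<Sum>l\<in>S. ?w / 2 + (?s - 1) * c)"
  proof (rule sum_mono)
    fix l assume l: "l \<in> S"
    have "(\<Sum>l'\<in>S. real (card {D \<in> \<Omega>. R l D \<and> R l' D}))
        = real (card {D \<in> \<Omega>. R l D}) + (\<Sum>l'\<in>S - {l}. real (card {D \<in> \<Omega>. R l D \<and> R l' D}))"
      using l fin by (subst sum.remove[of S l]) auto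
    also have "\<dots> \<le> ?w / 2 + (\<Sum>l'\<in>S - {l}. c)"
      using half[OF l] pair[OF l] by (intro add_mono sum_mono) auto
    also have "(\<Sum>l'\<in>S - {l}. c) = (?s - 1) * c"
    proof -
      have "card S \<ge> 1" using l fin by (auto simp: Suc_le_eq card_gt_0_iff)
      then show ?thesis using l by (simp add: card_Diff_singleton of_nat_diff)
    qed
    finally show "(\<Sum>l'\<in>S. real (card {D \<in> \<Omega>. R l D \<and> R l' D})) \<le> ?w / 2 + (?s - 1) * c" .
  qed
  finally have second: "(\<Sum>D\<in>\<Omega>. (n D)\<^sup>2) \<le> ?s * (?w / 2 + (?s - 1) * c)" by simp
  have "real (card T) * (?s\<^sup>2 / 4) = (\<Sum>D\<in>T. (n D - ?s / 2)\<^sup>2)"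
    using T(2) by (simp add: n_def power2_eq_square)
  also have "\<dots> \<le> (\<Sum>D\<in>\<Omega>. (n D - ?s / 2)\<^sup>2)"
    using fin T(1) by (intro sum_mono2) auto
  also have "\<dots> = (\<Sum>D\<in>\<Omega>. (n D)\<^sup>2 - ?s * n D + ?s\<^sup>2 / 4)"
    by (simp add: power2_diff power_divide algebra_simps)
  also have "\<dots> = (\<Sum>D\<in>\<Omega>. (n D)\<^sup>2) - ?s * (\<Sum>D\<in>\<Omega>. n D) + ?w * (?s\<^sup>2 / 4)"
    by (simp add: sum.distrib sum_subtractf sum_distrib_left)
  also have "\<dots> \<le> ?s * (?w / 2 + (?s - 1) * c) - ?s * (?s * ?w / 2) + ?w * (?s\<^sup>2 / 4)"
    using second unfolding first by simp
  finally have "?s * (real (card T) * ?s) \<le> ?s * (2 * ?w + 4 * (?s - 1) * c - ?s * ?w)"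
    by (simp add: power2_eq_square field_simps)
  moreover have "?s > 0" using assms by (simp add: card_gt_0_iff)
  ultimately show ?thesis using mult_le_cancel_left_pos by blast
qed

text \<open>The affine map \<open>x \<mapsto> \<alpha> x + \<beta>\<close> and the map \<open>x \<mapsto> (a x + b) / (x + d)\<close>, which does not fix \<open>\<infinity>\<close>, agree
  in no point of the projective line.\<close>

definition misses :: "'a::field \<times> 'a \<Rightarrow> 'a \<times> 'a \<times> 'a \<Rightarrow> bool" where
  "misses = (\<lambda>(\<alpha>, \<beta>) (a, b, d). rootless \<alpha> (\<beta> + \<alpha> * d - a) (\<beta> * d - b))"

text \<open>If \<open>a * d = b\<close>, numerator and denominator of
  \<open>(a x + b) / (x + d)\<close> vanish together at \<open>x = -d\<close>, which is then a
  root.\<close>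

lemma misses_nonsingular:
  assumes "misses l (a, b, d)" shows "a * d \<noteq> b"
proof
  assume ad: "a * d = b"
  obtain \<alpha> \<beta> where l: "l = (\<alpha>, \<beta>)" by force
  have "\<alpha> * (-d)\<^sup>2 + (\<beta> + \<alpha> * d - a) * (-d) + (\<beta> * d - b) = 0"
    using ad by (simp add: power2_eq_square algebra_simps)
  then show False using assms unfolding l misses_def rootless_def by blast
qed

lemma card_nonsingular:
  "real (card {(a, b, d). a * d \<noteq> (b::'a::{field,finite})}) = (real CARD('a))\<^sup>2 * (real CARD('a) - 1)"
proof -
  let ?f = "\<lambda>(a, d, k::'a). (a, a * d - k, d)"
  have "{(a, b, d). a * d \<noteq> (b::'a)} = ?f ` (UNIV \<times> UNIV \<times> (UNIV - {0}))"
    (is "?L = _ ` ?A")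
  proof
    show "?f ` ?A \<subseteq> ?L" by auto
    show "?L \<subseteq> ?f ` ?A"
    proof
      fix D assume D: "D \<in> ?L"
      obtain a b d where [simp]: "D = (a, b, d)" by (cases D)
      have "D = ?f (a, d, a * d - b)" by simp
      moreover have "(a, d, a * d - b) \<in> ?A" using D by simp
      ultimately show "D \<in> ?f ` ?A" by blast
    qed
  qed
  moreover have "inj_on ?f (UNIV \<times> UNIV \<times> (UNIV - {0}))" by (auto simp: inj_on_def)
  ultimately have "card {(a, b, d). a * d \<noteq> (b::'a)} = card ((UNIV::'a set) \<times> (UNIV::'a set) \<times> (UNIV - {0::'a}))"
    by (simp add: card_image)
  then show ?thesis
    by (simp add: card_cartesian_product real_card_nonzero power2_eq_square del: card_Diff_insert)
qed

text \<open>For fixed \<open>d\<close> the linear and constant coefficients of the quadratic are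
  free coordinates in place of \<open>a\<close> and \<open>b\<close>, so the count is
  \<open>q\<close> times \<open>sum_card_rootless\<close>. It is half of
  \<open>card_nonsingular\<close>.\<close>

lemma card_misses:
  fixes \<alpha> \<beta> :: "'a::{field,finite}"
  assumes "\<alpha> \<noteq> 0"
  shows "2 * real (card {D. misses (\<alpha>, \<beta>) D}) = (real CARD('a))\<^sup>2 * (real CARD('a) - 1)"
proof -
  let ?f = "\<lambda>(d, k, u). (\<beta> + \<alpha> * d - u, \<beta> * d - k, d)"
    and ?A = "(UNIV::'a set) \<times> (SIGMA k:UNIV. {u. rootless \<alpha> u k})"
  have "{D. misses (\<alpha>, \<beta>) D} = ?f ` ?A"
  proof
    show "?f ` ?A \<subseteq> {D. misses (\<alpha>, \<beta>) D}" by (auto simp: misses_def)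
    show "{D. misses (\<alpha>, \<beta>) D} \<subseteq> ?f ` ?A"
    proof
      fix D assume D: "D \<in> {D. misses (\<alpha>, \<beta>) D}"
      obtain a b d where [simp]: "D = (a, b, d)" by (cases D)
      have "D = ?f (d, \<beta> * d - b, \<beta> + \<alpha> * d - a)" by simp
      moreover have "(d, \<beta> * d - b, \<beta> + \<alpha> * d - a) \<in> ?A" using D by (simp add: misses_def)
      ultimately show "D \<in> ?f ` ?A" by blast
    qed
  qed
  moreover have "inj_on ?f ?A" by (auto simp: inj_on_def)
  ultimately have "card {D. misses (\<alpha>, \<beta>) D} = card ?A" by (simp add: card_image)
  also have "\<dots> = CARD('a) * (\<Sum>k\<in>UNIV. card {u. rootless \<alpha> u k})"
    by (simp add: card_cartesian_product)
  finally have "real (card {D. misses (\<alpha>, \<beta>) D})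
      = real CARD('a) * (\<Sum>k\<in>UNIV. real (card {u. rootless \<alpha> u k}))" by simp
  then show ?thesis by (simp add: sum_card_rootless[OF assms] power2_eq_square)
qed

lemma rootless_shift:
  assumes "rootless a b c"
  shows "rootless a (2 * a * x0 + b) (a * x0\<^sup>2 + b * x0 + c)"
proof -
  have "a * y\<^sup>2 + (2 * a * x0 + b) * y + (a * x0\<^sup>2 + b * x0 + c)
      = a * (y + x0)\<^sup>2 + b * (y + x0) + c" for y
    by (simp add: power2_eq_square algebra_simps)
  then show ?thesis using assms unfolding rootless_def by (metis add.assoc)
qed

text \<open>Two affine maps that agree at \<open>x0\<close> give quadratics with the same value at \<open>x0\<close>, and this common
  value and the two linear coefficients in \<open>y = x - x0\<close> are independent coordinates for \<open>D\<close>.\<close>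

lemma card_misses_secant_le:
  fixes \<alpha> \<beta> :: "'a::{field,finite}"
  assumes "\<alpha> \<noteq> 0" "\<alpha>' \<noteq> 0" "\<alpha> \<noteq> \<alpha>'"
  shows "real (card {D. misses (\<alpha>, \<beta>) D \<and> misses (\<alpha>', \<beta>') D})
    \<le> (real CARD('a) - 1) * ((real CARD('a))\<^sup>2 + 1) / 4"
proof -
  define x0 where "x0 = (\<beta>' - \<beta>) / (\<alpha> - \<alpha>')"
  have "(\<alpha> - \<alpha>') * x0 = \<beta>' - \<beta>" using assms by (simp add: x0_def)
  then have meet: "\<alpha>' * x0 + \<beta>' = \<alpha> * x0 + \<beta>" by (simp add: algebra_simps)
  define val where "val a b d = (\<alpha> * x0 + \<beta>) * (x0 + d) - (a * x0 + b)" for a b d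
  have val: "\<alpha> * x0\<^sup>2 + (\<beta> + \<alpha> * d - a) * x0 + (\<beta> * d - b) = val a b d" for a b d
    unfolding val_def by (simp add: power2_eq_square algebra_simps)
  have val': "\<alpha>' * x0\<^sup>2 + (\<beta>' + \<alpha>' * d - a) * x0 + (\<beta>' * d - b) = val a b d" for a b d
    unfolding val_def meet[symmetric] by (simp add: power2_eq_square algebra_simps)
  let ?f = "\<lambda>(a, b, d). (val a b d, 2 * \<alpha> * x0 + (\<beta> + \<alpha> * d - a), 2 * \<alpha>' * x0 + (\<beta>' + \<alpha>' * d - a))"
    and ?A = "SIGMA k:UNIV. {u. rootless \<alpha> u k} \<times> {u. rootless \<alpha>' u k}"
    and ?B = "{D. misses (\<alpha>, \<beta>) D \<and> misses (\<alpha>', \<beta>') D}"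
  have "inj_on ?f ?B"
  proof (rule inj_onI)
    fix D D1 assume f: "?f D = ?f D1"
    obtain a b d where D: "D = (a, b, d)" by (cases D)
    obtain a1 b1 d1 where D1: "D1 = (a1, b1, d1)" by (cases D1)
    have eq: "val a b d = val a1 b1 d1"
      "2 * \<alpha> * x0 + (\<beta> + \<alpha> * d - a) = 2 * \<alpha> * x0 + (\<beta> + \<alpha> * d1 - a1)"
      "2 * \<alpha>' * x0 + (\<beta>' + \<alpha>' * d - a) = 2 * \<alpha>' * x0 + (\<beta>' + \<alpha>' * d1 - a1)"
      using f unfolding D D1 by simp_all
    have e1: "\<alpha> * d - a = \<alpha> * d1 - a1" using eq(2) by (simp add: algebra_simps)
    have e2: "\<alpha>' * d - a = \<alpha>' * d1 - a1" using eq(3) by (simp add: algebra_simps)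
    have "(\<alpha> - \<alpha>') * d = (\<alpha> - \<alpha>') * d1" using e1 e2 by algebra
    then have d: "d = d1" using assms by simp
    then have a: "a = a1" using e1 by simp
    then show "D = D1" using d eq(1) unfolding D D1 by (simp add: val_def)
  qed
  moreover have "?f ` ?B \<subseteq> ?A"
  proof (rule image_subsetI)
    fix D assume D: "D \<in> ?B"
    obtain a b d where [simp]: "D = (a, b, d)" by (cases D)
    have "rootless \<alpha> (\<beta> + \<alpha> * d - a) (\<beta> * d - b)" "rootless \<alpha>' (\<beta>' + \<alpha>' * d - a) (\<beta>' * d - b)"
      using D by (simp_all add: misses_def)
    from this[THEN rootless_shift[where ?x0.0=x0]] show "?f D \<in> ?A"
      by (simp add: val val')
  qed
  ultimately have "card ?B \<le> card ?A" by (intro card_inj_on_le) auto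
  also have "card ?A = (\<Sum>k\<in>UNIV. card {u. rootless \<alpha> u k} * card {u. rootless \<alpha>' u k})"
    by (simp add: card_cartesian_product)
  finally have "real (card ?B) \<le> (\<Sum>k\<in>UNIV. real (card {u. rootless \<alpha> u k}) * real (card {u. rootless \<alpha>' u k}))"
    by (simp flip: of_nat_mult of_nat_sum)
  with sum_card_rootless_mult_le[OF assms(1,2)] show ?thesis by linarith
qed

text \<open>Parallel maps agree at no finite point, so other coordinates are used:
  \<open>\<alpha> * d - a\<close> and the two constant terms. The first two of them take
  \<open>q * (q - 1) / 2\<close> admissible pairs of values, and each pair allows at most
  \<open>q / 2\<close> values of the second constant.\<close>

lemma card_misses_parallel_le:
  fixes \<alpha> \<beta> :: "'a::{field,finite}"
  assumes "\<alpha> \<noteq> 0" "\<beta> \<noteq> \<beta>'"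
  shows "real (card {D. misses (\<alpha>, \<beta>) D \<and> misses (\<alpha>, \<beta>') D})
    \<le> (real CARD('a) - 1) * ((real CARD('a))\<^sup>2 + 1) / 4"
proof -
  let ?q = "real CARD('a)"
  let ?f = "\<lambda>(a, b, d). (\<alpha> * d - a, \<beta> * d - b, \<beta>' * d - b)"
    and ?A = "SIGMA w:UNIV. {k. rootless \<alpha> (\<beta> + w) k} \<times> {k. rootless \<alpha> (\<beta>' + w) k}"
    and ?B = "{D. misses (\<alpha>, \<beta>) D \<and> misses (\<alpha>, \<beta>') D}"
  have "inj_on ?f ?B"
  proof (rule inj_onI)
    fix D D1 assume f: "?f D = ?f D1"
    obtain a b d where D: "D = (a, b, d)" by (cases D)
    obtain a1 b1 d1 where D1: "D1 = (a1, b1, d1)" by (cases D1)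
    have eq: "\<alpha> * d - a = \<alpha> * d1 - a1" "\<beta> * d - b = \<beta> * d1 - b1" "\<beta>' * d - b = \<beta>' * d1 - b1"
      using f unfolding D D1 by simp_all
    have "(\<beta> - \<beta>') * d = (\<beta> - \<beta>') * d1" using eq by algebra
    then have d: "d = d1" using assms by simp
    then show "D = D1" using eq unfolding D D1 by simp
  qed
  moreover have "?f ` ?B \<subseteq> ?A" by (auto simp: misses_def add_diff_eq)
  ultimately have "card ?B \<le> card ?A" by (intro card_inj_on_le) auto
  also have "card ?A = (\<Sum>w\<in>UNIV. card {k. rootless \<alpha> (\<beta> + w) k} * card {k. rootless \<alpha> (\<beta>' + w) k})"
    by (simp add: card_cartesian_product)
  finally have "real (card ?B) \<le> (\<Sum>w\<in>UNIV. real (card {k. rootless \<alpha> (\<beta> + w) k}) * real (card {k. rootless \<alpha> (\<beta>' + w) k}))"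
    by (simp flip: of_nat_mult of_nat_sum)
  also have "\<dots> \<le> (\<Sum>w\<in>UNIV. real (card {k. rootless \<alpha> (\<beta> + w) k}) * (?q / 2))"
  proof (intro sum_mono mult_left_mono)
    fix w show "real (card {k. rootless \<alpha> (\<beta>' + w) k}) \<le> ?q / 2"
      using card_rootless_const_le[OF assms(1), of "\<beta>' + w"] by linarith
  qed simp
  also have "\<dots> = (?q / 2) * (\<Sum>w\<in>UNIV. real (card {k. rootless \<alpha> (\<beta> + w) k}))"
    by (simp add: sum_distrib_left mult.commute)
  also have "(\<Sum>w\<in>UNIV. real (card {k. rootless \<alpha> (\<beta> + w) k})) = (\<Sum>u\<in>UNIV. real (card {k. rootless \<alpha> u k}))"
    by (rule sum.reindex_bij_witness[of _ "\<lambda>u. u - \<beta>" "\<lambda>w. \<beta> + w"]) auto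
  also have "\<dots> = (\<Sum>u\<in>UNIV. \<Sum>k\<in>UNIV. of_bool (rootless \<alpha> u k))"
    by (simp add: card_of_bool_sum)
  also have "\<dots> = (\<Sum>k\<in>UNIV. \<Sum>u\<in>UNIV. of_bool (rootless \<alpha> u k))"
    by (rule sum.swap)
  also have "\<dots> = (\<Sum>k\<in>UNIV. real (card {u. rootless \<alpha> u k}))"
    by (simp add: card_of_bool_sum)
  also have "?q / 2 * \<dots> \<le> (?q - 1) * (?q\<^sup>2 + 1) / 4"
    unfolding sum_card_rootless[OF assms(1)] by (simp add: field_simps power2_eq_square)
  finally show ?thesis .
qed

text \<open>This is \<open>second_moment_bound\<close> with all nonsingular triples as \<Omega> and
  \<open>misses\<close> as the relation. The excess \<open>(q - 1) / 4\<close> of the pair bound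
  over a quarter of \<open>card \<Omega>\<close> becomes the term
  \<open>(q - 1) * card S\<close>.\<close>

lemma card_cross_intersecting_le:
  fixes S :: "('a::{field,finite} \<times> 'a) set" and T :: "('a \<times> 'a \<times> 'a) set"
  assumes S: "\<And>\<alpha> \<beta>. (\<alpha>, \<beta>) \<in> S \<Longrightarrow> \<alpha> \<noteq> 0"
    and T: "\<And>a b d. (a, b, d) \<in> T \<Longrightarrow> a * d \<noteq> b"
    and meet: "\<And>l D. l \<in> S \<Longrightarrow> D \<in> T \<Longrightarrow> \<not> misses l D"
  shows "real (card T) * real (card S) \<le> (real CARD('a) - 1) * ((real CARD('a))\<^sup>2 + real (card S))"
proof (cases "S = {}")
  case False
  let ?q = "real CARD('a)" and ?\<Omega> = "{(a, b, d). a * d \<noteq> (b::'a)}"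
  have \<Omega>: "{D \<in> ?\<Omega>. misses l D} = {D. misses l D}"
    "{D \<in> ?\<Omega>. misses l D \<and> misses l' D} = {D. misses l D \<and> misses l' D}" for l l'
    using misses_nonsingular[of l] by auto
  have "real (card T) * real (card S) \<le> 2 * real (card ?\<Omega>)
      + 4 * (real (card S) - 1) * ((?q - 1) * (?q\<^sup>2 + 1) / 4) - real (card S) * card ?\<Omega>"
  proof (rule second_moment_bound[OF _ _ False])
    fix l assume "l \<in> S"
    then show "2 * real (card {D \<in> ?\<Omega>. misses l D}) = card ?\<Omega>"
      unfolding \<Omega> using S card_misses card_nonsingular[where 'a='a] by (cases l) auto
  next
    fix l l' assume ll: "l \<in> S" "l' \<in> S" "l \<noteq> l'"
    obtain \<alpha> \<beta> \<alpha>' \<beta>' where l: "l = (\<alpha>, \<beta>)" "l' = (\<alpha>', \<beta>')" by (cases l, cases l')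
    have "\<alpha> \<noteq> 0" "\<alpha>' \<noteq> 0" using S ll l by auto
    then show "real (card {D \<in> ?\<Omega>. misses l D \<and> misses l' D}) \<le> (?q - 1) * (?q\<^sup>2 + 1) / 4"
      using ll card_misses_secant_le[of \<alpha> \<alpha>' \<beta> \<beta>'] card_misses_parallel_le[of \<alpha> \<beta> \<beta>']
      unfolding \<Omega> l by (cases "\<alpha> = \<alpha>'") auto
  qed (use T meet in auto)
  then have "real (card T) * real (card S) \<le> (?q - 1) * (?q\<^sup>2 + real (card S) - 1)"
    unfolding card_nonsingular by (simp add: field_simps)
  also have "\<dots> \<le> (?q - 1) * (?q\<^sup>2 + real (card S))"
    by (intro mult_left_mono) (auto simp: Suc_leI)
  finally show ?thesis .
qed (simp add: Suc_leI)

text \<open>In the variable \<open>y = x + d\<close> the constant term becomes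
  \<open>a * d - b\<close>, the same for all lines. Each slope \<alpha> then leaves about half of
  the intercepts, and the corrections sum exactly over \<alpha>.\<close>

lemma card_lines_meeting_le:
  fixes S :: "('a::{field,finite} \<times> 'a) set"
  assumes S: "\<And>\<alpha> \<beta>. (\<alpha>, \<beta>) \<in> S \<Longrightarrow> \<alpha> \<noteq> 0"
    and D: "a * d \<noteq> b" and meet: "\<And>l. l \<in> S \<Longrightarrow> \<not> misses l (a, b, d)"
  shows "2 * real (card S) \<le> real CARD('a) * (real CARD('a) - 1)"
proof -
  let ?q = "real CARD('a)" and ?k = "a * d - b"
  have k: "?k \<noteq> 0" using D by simp
  have meets: "\<not> rootless \<alpha> (\<beta> - \<alpha> * d - a) ?k" if l: "(\<alpha>, \<beta>) \<in> S" for \<alpha> \<beta>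
  proof -
    obtain x where x: "\<alpha> * x\<^sup>2 + (\<beta> + \<alpha> * d - a) * x + (\<beta> * d - b) = 0"
      using meet[OF l] unfolding misses_def rootless_def by auto
    have "\<alpha> * (x + d)\<^sup>2 + (\<beta> - \<alpha> * d - a) * (x + d) + ?k
        = \<alpha> * x\<^sup>2 + (\<beta> + \<alpha> * d - a) * x + (\<beta> * d - b)"
      by (simp add: power2_eq_square algebra_simps)
    then show ?thesis using x unfolding rootless_def by metis
  qed
  let ?f = "\<lambda>(\<alpha>, \<beta>). (\<alpha>, \<beta> - \<alpha> * d - a)" and ?A = "SIGMA \<alpha>:UNIV - {0}. UNIV - {u. rootless \<alpha> u ?k}"
  have "inj_on ?f S" by (auto simp: inj_on_def)
  moreover have "?f ` S \<subseteq> ?A" using S meets by auto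
  ultimately have "card S \<le> card ?A" by (intro card_inj_on_le) auto
  also have "card ?A = (\<Sum>\<alpha>\<in>UNIV - {0}. card (UNIV - {u. rootless \<alpha> u ?k}))" by simp
  finally have "real (card S) \<le> (\<Sum>\<alpha>\<in>UNIV - {0}. real (card (UNIV - {u. rootless \<alpha> u ?k})))"
    by (simp only: flip: of_nat_sum)
  also have "\<dots> = (\<Sum>\<alpha>\<in>UNIV - {0}. (?q - 1) / 2 + real (card {y. \<alpha> * y\<^sup>2 = ?k}) / 2)"
  proof (rule sum.cong[OF refl])
    fix \<alpha> :: 'a assume "\<alpha> \<in> UNIV - {0}"
    then have \<alpha>: "\<alpha> \<noteq> 0" by simp
    have "real (card (UNIV - {u. rootless \<alpha> u ?k})) = ?q - real (card {u. rootless \<alpha> u ?k})"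
      by (simp add: card_Diff_subset of_nat_diff card_mono)
    then show "real (card (UNIV - {u. rootless \<alpha> u ?k})) = (?q - 1) / 2 + real (card {y. \<alpha> * y\<^sup>2 = ?k}) / 2"
      using real_card_rootless_linear_coeff[OF \<alpha>, of ?k] k by (simp add: field_simps)
  qed
  also have "\<dots> = (?q - 1) * ((?q - 1) / 2) + (\<Sum>\<alpha>\<in>UNIV - {0}. real (card {y. \<alpha> * y\<^sup>2 = ?k})) / 2"
    by (simp only: sum.distrib sum_constant real_card_nonzero flip: sum_divide_distrib)
  also have "(\<Sum>\<alpha>\<in>UNIV - {0}. real (card {y. \<alpha> * y\<^sup>2 = ?k})) = ?q - 1"
    using sum_card_scaled_square_lead[OF k] real_card_nonzero[where 'a='a] by (metis of_nat_sum)
  finally show ?thesis by (simp add: field_simps)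
qed

section \<open>Tangency of matrices\<close>

text \<open>The determinant with columns \<open>v\<close> and \<open>w\<close>. For nonzero vectors
  it vanishes iff they span the same line, so for invertible matrices \<open>meets\<close> expresses
  agreement at a point of the projective line.\<close>

definition cross :: "'a::field^2 \<Rightarrow> 'a^2 \<Rightarrow> 'a" where
  "cross v w = v$1 * w$2 - v$2 * w$1"

definition meets :: "'a::field^2^2 \<Rightarrow> 'a^2^2 \<Rightarrow> bool" where
  "meets A B \<longleftrightarrow> (\<exists>v. v \<noteq> 0 \<and> cross (A *v v) (B *v v) = 0)"

text \<open>The polarisation of \<open>det\<close>: as a polynomial in \<open>c\<close>,
  \<open>det (A - c B)\<close> is \<open>det B * c\<^sup>2 - polar A B * c + det A\<close>.\<close>

definition polar :: "'a::field^2^2 \<Rightarrow> 'a^2^2 \<Rightarrow> 'a" where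
  "polar A B = A$1$1 * B$2$2 + A$2$2 * B$1$1 - A$1$2 * B$2$1 - A$2$1 * B$1$2"

text \<open>The binary form \<open>v \<mapsto> cross (A *v v) (B *v v)\<close> is a constant times the square of a linear form:
  \<open>A\<close> and \<open>B\<close> are proportional or agree in exactly one point of the projective line. The formulation by
  the double root \<open>c\<close> of \<open>det (A - c B)\<close> is also correct in characteristic two.\<close>

definition tangent :: "'a::field^2^2 \<Rightarrow> 'a^2^2 \<Rightarrow> bool" where
  "tangent A B \<longleftrightarrow> (\<exists>c. det B * c\<^sup>2 = det A \<and> polar A B = 2 * c * det B)"

lemma matrix2_eq_iff:
  "A = (B::'a^2^2) \<longleftrightarrow> A$1$1 = B$1$1 \<and> A$1$2 = B$1$2 \<and> A$2$1 = B$2$1 \<and> A$2$2 = B$2$2"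
  by (auto simp: vec_eq_iff forall_2)

lemma vec2_eq_iff: "v = (w::'a^2) \<longleftrightarrow> v$1 = w$1 \<and> v$2 = w$2"
  by (auto simp: vec_eq_iff forall_2)

lemma matrix2_mult_vec_nth: "(A *v v)$i = A$i$1 * v$1 + A$i$2 * (v::'a::field^2)$2"
  by (simp add: matrix_vector_mult_def sum_2)

lemma matrix2_mult_nth: "(A ** B)$i$j = A$i$1 * B$1$j + A$i$2 * (B::'a::field^2^2)$2$j"
  by (simp add: matrix_matrix_mult_def sum_2)

lemma scalar_mult_nth [simp]: "(mat c ** A)$i$j = c * (A::'a::field^2^2)$i$j"
  using exhaust_2[of i] by (auto simp: matrix_matrix_mult_def mat_def sum_2)

lemma det_scalar_mult [simp]: "det (mat c ** A) = c\<^sup>2 * det (A::'a::field^2^2)"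
  by (simp add: det_2 power2_eq_square algebra_simps)

lemma polar_scalar_mult [simp]:
  "polar (mat c ** A) B = c * polar A B" "polar A (mat c ** B) = c * polar A B"
  by (simp_all add: polar_def algebra_simps)

lemma polar_commute: "polar A B = polar B A"
  by (simp add: polar_def algebra_simps)

lemma polar_eq_det: "polar A B = det (A + B) - det A - det B"
  by (simp add: polar_def det_2 algebra_simps)

lemma polar_mult: "polar (S ** A ** R) (S ** B ** R) = det S * det R * polar A B"
proof -
  have "S ** A ** R + S ** B ** R = S ** (A + B) ** R"
    by (simp add: matrix2_eq_iff matrix2_mult_nth algebra_simps)
  then show ?thesis by (simp add: polar_eq_det det_mul algebra_simps)
qed

lemma det_mult3: "det (S ** A ** R) = det S * det R * det (A::'a::field^2^2)"
  by (simp add: det_mul algebra_simps)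

lemma cross_mult: "cross (A *v v) (A *v w) = det A * cross v w"
  by (simp add: cross_def det_2 matrix2_mult_vec_nth algebra_simps)

lemma cross_scale [simp]: "cross (c *s v) w = c * cross v w" "cross v (c *s w) = c * cross v w"
  by (simp_all add: cross_def algebra_simps)

lemma cross_self [simp]: "cross v v = 0"
  by (simp add: cross_def)

lemma invertible_mult_vec_nonzero:
  fixes A :: "'a::field^2^2"
  assumes "det A \<noteq> 0" "v \<noteq> 0" shows "A *v v \<noteq> 0"
  using assms by (metis inj_matrix_vector_mult invertible_det_nz matrix_vector_mult_0_right injD)

lemma cross_eq_0_iff:
  assumes "w \<noteq> 0" shows "cross v w = 0 \<longleftrightarrow> (\<exists>c. v = c *s w)"
proof
  assume c: "cross v w = 0"
  show "\<exists>c. v = c *s w"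
  proof (cases "w$1 = 0")
    case True
    then have w: "w$2 \<noteq> 0" using assms by (auto simp: vec2_eq_iff)
    then have "v = (v$2 / w$2) *s w" using c True by (auto simp: vec2_eq_iff cross_def)
    then show ?thesis by blast
  next
    case False
    then have "v = (v$1 / w$1) *s w"
      using c by (auto simp: vec2_eq_iff cross_def field_simps)
    then show ?thesis by blast
  qed
qed auto

lemma mult_invertible_right_cancel:
  fixes S A R :: "'a::field^2^2"
  assumes "det S \<noteq> 0" "det R \<noteq> 0" "S ** A ** R = S ** B ** R"
  shows "A = B"
proof -
  obtain S' where S': "S' ** S = mat 1" using assms(1) by (metis invertible_def invertible_det_nz)
  obtain R' where R': "R ** R' = mat 1" using assms(2) by (metis invertible_def invertible_det_nz)
  have "S' ** (S ** X ** R) ** R' = X" for X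
    by (metis S' R' matrix_mul_assoc matrix_mul_lid matrix_mul_rid)
  then show ?thesis using assms(3) by metis
qed

text \<open>\<open>R\<close> has first column \<open>v\<close> and \<open>S\<close> has second row
  \<open>(- w$2, w$1)\<close>. The base change makes \<open>A\<close> upper triangular exactly if
  \<open>A *v v\<close> is proportional to \<open>w\<close>.\<close>

lemma triangularize:
  fixes v w :: "'a::field^2"
  assumes "v \<noteq> 0" "w \<noteq> 0"
  obtains S R :: "'a^2^2" where "det S \<noteq> 0" "det R \<noteq> 0" "R *v vector [1, 0] = v"
    "\<And>A. (S ** A ** R)$2$1 = - cross (A *v v) w"
proof -
  define R :: "'a^2^2" where
    "R = (if v$1 \<noteq> 0 then vector [vector [v$1, 0], vector [v$2, 1]] else vector [vector [v$1, 1], vector [v$2, 0]])"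
  define S :: "'a^2^2" where
    "S = (if w$1 \<noteq> 0 then vector [vector [1, 0], vector [-w$2, w$1]] else vector [vector [0, 1], vector [-w$2, w$1]])"
  show ?thesis
  proof (rule that)
    show "det S \<noteq> 0" "det R \<noteq> 0" "R *v vector [1, 0] = v"
      using assms by (auto simp: S_def R_def det_2 vec2_eq_iff matrix2_mult_vec_nth)
    show "(S ** A ** R)$2$1 = - cross (A *v v) w" for A
      by (auto simp: S_def R_def cross_def matrix2_mult_nth matrix2_mult_vec_nth algebra_simps)
  qed
qed

text \<open>Triangularizing at a point \<open>v\<close> of agreement, with target
  \<open>B *v v\<close>, makes both matrices triangular at once.\<close>

lemma meets_triangular:
  fixes A B :: "'a::field^2^2"
  assumes "meets A B" "det B \<noteq> 0"
  obtains S R v where "det S \<noteq> 0" "det R \<noteq> 0" "v \<noteq> 0" "R *v vector [1, 0] = v"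
    "cross (A *v v) (B *v v) = 0" "(S ** A ** R)$2$1 = 0" "(S ** B ** R)$2$1 = 0"
proof -
  obtain v where v: "v \<noteq> 0" "cross (A *v v) (B *v v) = 0" using assms unfolding meets_def by blast
  have "B *v v \<noteq> 0" by (rule invertible_mult_vec_nonzero) (use assms v in auto)
  from triangularize[OF v(1) this] obtain S R where "det S \<noteq> 0" "det R \<noteq> 0" "R *v vector [1, 0] = v"
    "\<And>M. (S ** M ** R)$2$1 = - cross (M *v v) (B *v v)" by metis
  then show ?thesis using v by (intro that[of S R v]) auto
qed

lemma meets_mult:
  fixes S R A B :: "'a::field^2^2"
  assumes "meets A B" "det R \<noteq> 0"
  shows "meets (S ** A ** R) (S ** B ** R)"
proof -
  obtain v where v: "v \<noteq> 0" "cross (A *v v) (B *v v) = 0" using assms unfolding meets_def by blast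
  obtain R' where R': "R ** R' = mat 1" using assms(2) by (metis invertible_def invertible_det_nz)
  have Rv: "R *v (R' *v v) = v" using R' by (simp add: matrix_vector_mul_assoc)
  have "(S ** X ** R) *v (R' *v v) = S *v (X *v v)" for X
    using Rv by (metis matrix_vector_mul_assoc)
  then have "cross ((S ** A ** R) *v (R' *v v)) ((S ** B ** R) *v (R' *v v)) = 0"
    using v by (simp add: cross_mult)
  moreover have "R' *v v \<noteq> 0" using Rv v by auto
  ultimately show ?thesis unfolding meets_def by blast
qed

text \<open>Lifts \<open>D\<close> of a common tangent element, normalised to \<open>det D = det A\<close>.\<close>

definition common_tangents :: "'a::field^2^2 \<Rightarrow> 'a^2^2 \<Rightarrow> 'a \<Rightarrow> ('a^2^2) set" where
  "common_tangents A B c = {D. det D = det A \<and> polar A D = 2 * det A \<and> polar D B = 2 * c * det B}"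

text \<open>The two conditions on \<open>polar\<close> are linear in the diagonal and the lower left
  entry of \<open>D\<close>, and the determinant is the third condition. In every case a single
  entry of \<open>D\<close> determines the others.\<close>

lemma card_common_tangents_triangular_le:
  fixes A B :: "'a::{field,finite}^2^2"
  assumes A: "A$2$1 = 0" "det A \<noteq> 0" and B: "B$2$1 = 0" "det B \<noteq> 0"
    and c: "det B * c\<^sup>2 = det A" and nonprop: "\<And>k. B \<noteq> mat k ** A"
  shows "card (common_tangents A B c) \<le> CARD('a)"
proof -
  obtain a1 b1 d1 where A': "A$1$1 = a1" "A$1$2 = b1" "A$2$2 = d1" by blast
  obtain a b d where B': "B$1$1 = a" "B$1$2 = b" "B$2$2 = d" by blast
  have nz: "a1 \<noteq> 0" "d1 \<noteq> 0" "a \<noteq> 0" "d \<noteq> 0" using A B A' B' by (auto simp: det_2)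
  have c': "a * d * c\<^sup>2 = a1 * d1" using c A B A' B' by (simp add: det_2)
  have mem: "D \<in> common_tangents A B c \<longleftrightarrow> D$1$1 * D$2$2 - D$1$2 * D$2$1 = a1 * d1 \<and>
      a1 * D$2$2 + d1 * D$1$1 - b1 * D$2$1 = 2 * a1 * d1 \<and>
      a * D$2$2 + d * D$1$1 - b * D$2$1 = 2 * c * a * d" for D
    using A B A' B' by (simp add: common_tangents_def polar_def det_2 algebra_simps)
  \<comment> \<open>\<open>d1 * p\<close> and \<open>a1 * z\<close> have sum
    \<open>2 * a1 * d1\<close> and product \<open>(a1 * d1)\<^sup>2\<close>, so both are the double
    root \<open>a1 * d1\<close>. This holds in characteristic two as well.\<close>
  have double: "p = a1 \<and> z = d1" if "p * z = a1 * d1" "a1 * z + d1 * p = 2 * a1 * d1" for p z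
  proof -
    have "(d1 * p - a1 * d1)\<^sup>2 = 0" using that by algebra
    then have "p = a1" using nz by (simp add: algebra_simps)
    then show ?thesis using that nz by simp
  qed
  show ?thesis
  proof (cases "a1 * d = a * d1")
    \<comment> \<open>Proportional diagonals: eliminating the diagonal of \<open>D\<close> leaves
      one equation for its lower left entry, with a nonzero coefficient by \<open>nonprop\<close>.
      So this entry is the same for all \<open>D\<close>.\<close>
    case True
    define k where "k = a / a1"
    have k: "a = k * a1" "d = k * d1" "k \<noteq> 0" using True nz by (auto simp: k_def field_simps)
    have "b - k * b1 \<noteq> 0"
    proof
      assume "b - k * b1 = 0"
      then have "B = mat k ** A" using k A B A' B' by (simp add: matrix2_eq_iff)
      with nonprop show False by blast
    qed
    moreover have "(b - k * b1) * D$2$1 = 2 * k * a1 * d1 - 2 * c * a * d"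
      if "D \<in> common_tangents A B c" for D
      using that unfolding mem k by algebra
    ultimately obtain s where s: "D$2$1 = s" if "D \<in> common_tangents A B c" for D
      by (metis nonzero_mult_div_cancel_left)
    show ?thesis
    proof (cases "s = 0")
      case True
      have "inj_on (\<lambda>D. D$1$2) (common_tangents A B c)"
      proof (rule inj_onI)
        fix D D' assume D: "D \<in> common_tangents A B c" "D' \<in> common_tangents A B c" and eq: "D$1$2 = D'$1$2"
        have "X$1$1 = a1 \<and> X$2$2 = d1" if X: "X \<in> common_tangents A B c" for X
          using X s[OF X] True by (intro double) (auto simp: mem)
        then show "D = D'" using D eq s by (simp add: matrix2_eq_iff)
      qed
      then show ?thesis by (metis card_inj_on_le finite_UNIV subset_UNIV finite)
    next
      case False
      have "inj_on (\<lambda>D. D$1$1) (common_tangents A B c)"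
      proof (rule inj_onI)
        fix D D' assume D: "D \<in> common_tangents A B c" "D' \<in> common_tangents A B c" and eq: "D$1$1 = D'$1$1"
        have X: "a1 * X$2$2 = 2 * a1 * d1 + b1 * s - d1 * X$1$1" "X$1$2 * s = X$1$1 * X$2$2 - a1 * d1"
          if "X \<in> common_tangents A B c" for X
          using that s[OF that] unfolding mem by algebra+
        have "a1 * D$2$2 = a1 * D'$2$2" using X(1) D eq by metis
        then have z: "D$2$2 = D'$2$2" using nz by simp
        have "D$1$2 * s = D'$1$2 * s" using X(2) D eq z by metis
        then show "D = D'" using D z eq s False by (simp add: matrix2_eq_iff)
      qed
      then show ?thesis by (metis card_inj_on_le finite_UNIV subset_UNIV finite)
    qed
  next
    case False
    have s: "D$2$1 \<noteq> 0" if D: "D \<in> common_tangents A B c" for D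
    proof
      assume "D$2$1 = 0"
      then have "D$1$1 = a1 \<and> D$2$2 = d1" using D by (intro double) (auto simp: mem)
      then have "a * d1 + d * a1 = 2 * c * a * d" using D \<open>D$2$1 = 0\<close> unfolding mem by auto
      \<comment> \<open>The square is
        \<open>(a1 * d + a * d1)\<^sup>2 - 4 * a * a1 * d * d1\<close>, and both terms equal
        \<open>(2 * c * a * d)\<^sup>2\<close>, the second one by \<open>c'\<close>.\<close>
      then have "(a1 * d - a * d1)\<^sup>2 = 0" using c' by algebra
      with False show False by simp
    qed
    have "inj_on (\<lambda>D. D$2$1) (common_tangents A B c)"
    proof (rule inj_onI)
      fix D D' assume D: "D \<in> common_tangents A B c" "D' \<in> common_tangents A B c" and eq: "D$2$1 = D'$2$1"
      have e: "a1 * (D$2$2 - D'$2$2) + d1 * (D$1$1 - D'$1$1) = 0" "a * (D$2$2 - D'$2$2) + d * (D$1$1 - D'$1$1) = 0"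
        using D eq unfolding mem by algebra+
      have "(a1 * d - a * d1) * (D$1$1 - D'$1$1) = 0" using e by algebra
      then have p: "D$1$1 = D'$1$1" using False by simp
      then have z: "D$2$2 = D'$2$2" using e nz by simp
      have "D$1$2 * D$2$1 = D'$1$2 * D$2$1" using D eq p z unfolding mem by algebra
      then show "D = D'" using s[OF D(1)] eq p z by (simp add: matrix2_eq_iff)
    qed
    then show ?thesis by (metis card_inj_on_le finite_UNIV subset_UNIV finite)
  qed
qed

text \<open>The injective base change from \<open>D\<close> to \<open>S ** D ** R\<close> multiplies
  \<open>det\<close> and \<open>polar\<close> by the same factor \<open>det S * det R\<close>, so
  the defining equations persist with the same \<open>c\<close>.\<close>

lemma card_common_tangents_le:
  fixes A B :: "'a::{field,finite}^2^2"
  assumes "meets A B" "det A \<noteq> 0" "det B \<noteq> 0" "det B * c\<^sup>2 = det A" and nonprop: "\<And>k. B \<noteq> mat k ** A"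
  shows "card (common_tangents A B c) \<le> CARD('a)"
proof -
  obtain S R v where SR: "det S \<noteq> 0" "det R \<noteq> 0" and tri: "(S ** A ** R)$2$1 = 0" "(S ** B ** R)$2$1 = 0"
    using meets_triangular[OF assms(1,3)] by metis
  have "card (common_tangents A B c) \<le> card (common_tangents (S ** A ** R) (S ** B ** R) c)"
  proof (rule card_inj_on_le)
    show "inj_on (\<lambda>D. S ** D ** R) (common_tangents A B c)"
      using SR by (auto intro: inj_onI mult_invertible_right_cancel)
    show "(\<lambda>D. S ** D ** R) ` common_tangents A B c \<subseteq> common_tangents (S ** A ** R) (S ** B ** R) c"
      by (auto simp: common_tangents_def polar_mult det_mult3)
  qed simp
  also have "\<dots> \<le> CARD('a)"
  proof (rule card_common_tangents_triangular_le[OF tri(1) _ tri(2)])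
    fix k
    show "S ** B ** R \<noteq> mat k ** (S ** A ** R)"
    proof
      assume "S ** B ** R = mat k ** (S ** A ** R)"
      then have "S ** B ** R = S ** (mat k ** A) ** R"
        by (metis mat_mult_commute matrix_mul_assoc)
      then show False using mult_invertible_right_cancel SR nonprop by metis
    qed
  qed (use assms SR in \<open>auto simp: det_mult3\<close>)
  finally show ?thesis .
qed

lemma tangent_sym:
  assumes "det A \<noteq> 0" "tangent A B" shows "tangent B A"
proof -
  obtain c where c: "det B * c\<^sup>2 = det A" "polar A B = 2 * c * det B"
    using assms unfolding tangent_def by blast
  then have "c \<noteq> 0" using assms by auto
  moreover have "det A * (1 / c)\<^sup>2 = det B" using c \<open>c \<noteq> 0\<close> by (simp add: field_simps)
  moreover have "polar B A = 2 * (1 / c) * det A"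
    using c \<open>c \<noteq> 0\<close> by (simp add: polar_commute[of B] field_simps power2_eq_square flip: c(1))
  ultimately show ?thesis unfolding tangent_def by blast
qed

lemma tangent_scalar_right:
  assumes "k \<noteq> 0" shows "tangent A (mat k ** B) \<longleftrightarrow> tangent A B"
proof
  assume "tangent A (mat k ** B)"
  then obtain c where "k\<^sup>2 * det B * c\<^sup>2 = det A" "k * polar A B = 2 * c * (k\<^sup>2 * det B)"
    unfolding tangent_def by auto
  then have "det B * (k * c)\<^sup>2 = det A" "polar A B = 2 * (k * c) * det B"
    using assms by (simp_all add: power2_eq_square algebra_simps)
  then show "tangent A B" unfolding tangent_def by blast
next
  assume "tangent A B"
  then obtain c where "det B * c\<^sup>2 = det A" "polar A B = 2 * c * det B"
    unfolding tangent_def by auto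
  then have "det (mat k ** B) * (c / k)\<^sup>2 = det A" "polar A (mat k ** B) = 2 * (c / k) * det (mat k ** B)"
    using assms by (simp_all add: power2_eq_square)
  then show "tangent A (mat k ** B)" unfolding tangent_def by blast
qed

section \<open>Square classes of determinants and counts of tangent matrices\<close>

text \<open>The square roots of \<open>x / y\<close> for nonzero \<open>y\<close>. Over a finite
  field and for nonzero \<open>x\<close> there are 0 or 2 in odd characteristic and 1 in
  characteristic two, so their number is a weight for square classes that treats all
  \<open>q\<close> alike.\<close>

definition square_ratios :: "'a::field \<Rightarrow> 'a \<Rightarrow> 'a set" where
  "square_ratios x y = {c. y * c\<^sup>2 = x}"

lemma card_square_ratios_commute:
  assumes "x \<noteq> 0" "y \<noteq> 0"
  shows "card (square_ratios x y) = card (square_ratios y x)"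
proof -
  have "bij_betw inverse (square_ratios x y) (square_ratios y x)"
    using assms by (intro bij_betwI[where g=inverse]) (auto simp: square_ratios_def field_simps)
  then show ?thesis by (rule bij_betw_same_card)
qed

lemma card_square_ratios_square_mult:
  assumes "k \<noteq> 0"
  shows "card (square_ratios x (y * k\<^sup>2)) = card (square_ratios x y)"
proof -
  have "bij_betw ((*) k) (square_ratios x (y * k\<^sup>2)) (square_ratios x y)"
    using assms by (intro bij_betwI[where g="\<lambda>c. c / k"])
      (auto simp: square_ratios_def field_simps power_mult_distrib)
  then show ?thesis by (rule bij_betw_same_card)
qed

text \<open>A root \<open>c\<close> of \<open>x / z\<close> and a root \<open>d\<close> of
  \<open>z / y\<close> give the root \<open>c * d\<close> of \<open>x / y\<close>. Conversely
  \<open>c\<close> and \<open>c * d\<close> determine \<open>d\<close> and then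
  \<open>z\<close>.\<close>

lemma sum_card_square_ratios_le:
  fixes x y :: "'a::{field,finite}"
  assumes "x \<noteq> 0" "y \<noteq> 0"
  shows "(\<Sum>z\<in>UNIV - {0}. card (square_ratios x z) * card (square_ratios y z))
    \<le> card (UNIV - {0::'a}) * card (square_ratios x y)"
proof -
  let ?A = "SIGMA z:UNIV - {0}. square_ratios x z \<times> square_ratios z y"
  have "(\<Sum>z\<in>UNIV - {0}. card (square_ratios x z) * card (square_ratios y z)) = card ?A"
    using card_square_ratios_commute[OF assms(2)] by (simp add: card_cartesian_product)
  also have "\<dots> \<le> card ((UNIV - {0::'a}) \<times> square_ratios x y)"
  proof (rule card_inj_on_le)
    let ?f = "\<lambda>(z::'a, c::'a, d). (c, c * d)"
    show "inj_on ?f ?A"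
    proof (rule inj_onI)
      fix p p' assume p: "p \<in> ?A" "p' \<in> ?A" and f: "?f p = ?f p'"
      obtain z c d z' c' d' where [simp]: "p = (z, c, d)" "p' = (z', c', d')" by (cases p, cases p')
      have eq: "c = c'" "c * d = c' * d'" using f by auto
      have "x = z * c\<^sup>2" "z = y * d\<^sup>2" "z' = y * d'\<^sup>2" using p by (auto simp: square_ratios_def)
      moreover from this have "c \<noteq> 0" using assms by auto
      then have "d = d'" using eq by auto
      ultimately show "p = p'" using eq by simp
    qed
    show "?f ` ?A \<subseteq> (UNIV - {0::'a}) \<times> square_ratios x y"
    proof (rule image_subsetI)
      fix p assume p: "p \<in> ?A"
      obtain z c d where [simp]: "p = (z, c, d)" by (cases p)
      have "x = z * c\<^sup>2" "z = y * d\<^sup>2" using p by (auto simp: square_ratios_def)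
      then have "c \<noteq> 0" "y * (c * d)\<^sup>2 = x" using assms by (auto simp: power_mult_distrib)
      then show "?f p \<in> (UNIV - {0::'a}) \<times> square_ratios x y" by (simp add: square_ratios_def)
    qed
  qed simp
  finally show ?thesis by (simp only: card_cartesian_product)
qed

definition matrix2 :: "'a \<Rightarrow> 'a \<Rightarrow> 'a \<Rightarrow> 'a \<Rightarrow> 'a::zero^2^2" where
  "matrix2 a b c d = vector [vector [a, b], vector [c, d]]"

lemma matrix2_nth [simp]: "matrix2 a b c d $1$1 = a" "matrix2 a b c d $1$2 = b" "matrix2 a b c d $2$1 = c" "matrix2 a b c d $2$2 = d"
  by (simp_all add: matrix2_def)

lemma card_det_eq_le:
  fixes x :: "'a::{field,finite}"
  assumes "x \<noteq> 0"
  shows "card {D::'a^2^2. det D = x} \<le> card (UNIV - {0::'a}) * (CARD('a) * (CARD('a) + 1))"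
proof -
  let ?A = "{D::'a^2^2. det D = x \<and> D$1$1 \<noteq> 0}" and ?B = "{D::'a^2^2. det D = x \<and> D$1$1 = 0}"
  have "card ?A \<le> card ((UNIV - {0::'a}) \<times> (UNIV::'a set) \<times> (UNIV::'a set))"
  proof (rule card_inj_on_le)
    show "inj_on (\<lambda>D. (D$1$1, D$1$2, D$2$1)) ?A"
      by (auto simp: inj_on_def matrix2_eq_iff det_2)
  qed auto
  moreover have "card ?B \<le> card ((UNIV - {0::'a}) \<times> (UNIV::'a set))"
  proof (rule card_inj_on_le)
    show "inj_on (\<lambda>D. (D$1$2, D$2$2)) ?B"
      using assms by (auto simp: inj_on_def matrix2_eq_iff det_2)
    show "(\<lambda>D. (D$1$2, D$2$2)) ` ?B \<subseteq> (UNIV - {0::'a}) \<times> (UNIV::'a set)"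
      using assms by (auto simp: det_2)
  qed auto
  moreover have "card {D::'a^2^2. det D = x} \<le> card ?A + card ?B"
    by (rule order.trans[OF card_mono card_Un_le]) auto
  ultimately show ?thesis by (simp only: card_cartesian_product add_mult_distrib2 mult_1_right)
qed

text \<open>These are the matrices \<open>1 + N\<close> with \<open>N\<close> nilpotent, so
  \<open>D$1$2 * D$2$1 = - t\<^sup>2\<close> for \<open>t = D$1$1 - 1\<close>. The count splits on
  the lower left entry; if it vanishes, so does \<open>t\<close>.\<close>

lemma card_unipotent:
  "card {D::'a::{field,finite}^2^2. det D = 1 \<and> D$1$1 + D$2$2 = 2} = (CARD('a))\<^sup>2" (is "card ?U = _")
proof -
  let ?f = "\<lambda>(t, s). matrix2 (1 + t) (- t\<^sup>2 / s) s (1 - t) :: 'a^2^2" and ?g = "\<lambda>r. matrix2 1 r 0 1 :: 'a^2^2"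
  have "?U = ?f ` (UNIV \<times> (UNIV - {0})) \<union> range ?g"
  proof
    show "?f ` (UNIV \<times> (UNIV - {0})) \<union> range ?g \<subseteq> ?U"
      by (auto simp: det_2 power2_eq_square algebra_simps)
    show "?U \<subseteq> ?f ` (UNIV \<times> (UNIV - {0})) \<union> range ?g"
    proof
      fix D assume D: "D \<in> ?U"
      define t where "t = D$1$1 - 1"
      have p: "D$1$1 = 1 + t" "D$2$2 = 1 - t" using D unfolding t_def by (auto simp: algebra_simps)
      have r: "D$1$2 * D$2$1 = - t\<^sup>2" using D p unfolding det_2 mem_Collect_eq by algebra
      show "D \<in> ?f ` (UNIV \<times> (UNIV - {0})) \<union> range ?g"
      proof (cases "D$2$1 = 0")
        case True
        then have "D = ?g (D$1$2)" using p r by (simp add: matrix2_eq_iff)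
        then show ?thesis by blast
      next
        case False
        then have "D = ?f (t, D$2$1)" using p r by (simp add: matrix2_eq_iff field_simps)
        then show ?thesis using False by (intro UnI1 rev_image_eqI[of "(t, D$2$1)"]) auto
      qed
    qed
  qed
  moreover have "card (?f ` (UNIV \<times> (UNIV - {0})) \<union> range ?g) = card (?f ` (UNIV \<times> (UNIV - {0}))) + card (range ?g)"
    by (rule card_Un_disjoint) (auto simp: matrix2_eq_iff)
  moreover have "inj_on ?f (UNIV \<times> (UNIV - {0}))" "inj ?g" by (auto simp: inj_on_def matrix2_eq_iff)
  ultimately have "card ?U = CARD('a) * (CARD('a) - 1) + CARD('a)"
    by (simp add: card_image card_cartesian_product card_Diff_subset)
  also have "\<dots> = (CARD('a))\<^sup>2"
  proof (cases "CARD('a)")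
    case (Suc n) then show ?thesis by (simp add: power2_eq_square)
  qed simp
  finally show ?thesis .
qed

text \<open>Writing \<open>D = A ** X\<close> turns \<open>polar A D\<close> into
  \<open>det A\<close> times the trace of \<open>X\<close>, so \<open>X\<close> runs over the
  matrices of \<open>card_unipotent\<close>.\<close>

lemma card_normalized_tangents:
  fixes A :: "'a::{field,finite}^2^2"
  assumes "det A \<noteq> 0"
  shows "card {D. det D = det A \<and> polar A D = 2 * det A} = (CARD('a))\<^sup>2"
proof -
  obtain A' where A': "A' ** A = mat 1" "A ** A' = mat 1"
    using assms by (metis invertible_def invertible_det_nz)
  let ?U = "{D::'a^2^2. det D = 1 \<and> D$1$1 + D$2$2 = 2}"
  have polar_A: "polar A (A ** X) = det A * (X$1$1 + X$2$2)" for X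
    by (simp add: polar_def det_2 matrix2_mult_nth algebra_simps)
  have "bij_betw ((**) A) ?U {D. det D = det A \<and> polar A D = 2 * det A}"
  proof (rule bij_betwI[where g="(**) A'"])
    show "(**) A \<in> ?U \<rightarrow> {D. det D = det A \<and> polar A D = 2 * det A}"
      by (rule funcsetI) (simp add: det_mul polar_A mult.commute)
    show "(**) A' \<in> {D. det D = det A \<and> polar A D = 2 * det A} \<rightarrow> ?U"
    proof
      fix D assume D: "D \<in> {D. det D = det A \<and> polar A D = 2 * det A}"
      have AD: "A ** (A' ** D) = D" using A' by (simp add: matrix_mul_assoc)
      then have "det A * det (A' ** D) = det A" using D by (metis (mono_tags) det_mul mem_Collect_eq)
      moreover have "det A * ((A' ** D)$1$1 + (A' ** D)$2$2) = det A * 2"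
        using D polar_A[of "A' ** D"] AD by (simp add: mult.commute)
      ultimately show "A' ** D \<in> ?U" using assms by (simp only: mult_cancel_left) simp
    qed
  qed (simp_all add: matrix_mul_assoc A')
  from bij_betw_same_card[OF this] show ?thesis by (simp only: card_unipotent)
qed

lemma scalar_mult_inverse: "k \<noteq> 0 \<Longrightarrow> D = mat (1 / k) ** (mat k ** (D::'a::field^2^2))"
  by (simp add: matrix2_eq_iff)

text \<open>Every tangent matrix has exactly one multiple normalised as in
  \<open>card_normalized_tangents\<close>, obtained by scaling with the double root
  \<open>c\<close>.\<close>

lemma card_tangent:
  fixes A :: "'a::{field,finite}^2^2"
  assumes "det A \<noteq> 0"
  shows "card {D. det D \<noteq> 0 \<and> tangent A D} = card (UNIV - {0::'a}) * (CARD('a))\<^sup>2" (is "card ?T = _")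
proof -
  let ?U = "{D. det D = det A \<and> polar A D = 2 * det A}" and ?f = "\<lambda>(k, D). mat k ** D :: 'a^2^2"
  have "?T = ?f ` ((UNIV - {0}) \<times> ?U)"
  proof
    show "?f ` ((UNIV - {0}) \<times> ?U) \<subseteq> ?T"
    proof (rule image_subsetI)
      fix x :: "'a \<times> ('a^2^2)" assume x: "x \<in> (UNIV - {0}) \<times> ?U"
      obtain k D where [simp]: "x = (k, D)" by (cases x)
      have D: "k \<noteq> 0" "det D = det A" "polar A D = 2 * det A" using x by auto
      have "tangent A D" unfolding tangent_def using D by (intro exI[of _ 1]) simp
      then show "?f x \<in> ?T" using D assms by (simp add: tangent_scalar_right)
    qed
    show "?T \<subseteq> ?f ` ((UNIV - {0}) \<times> ?U)"
    proof
      fix D assume D: "D \<in> ?T"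
      then obtain c where c: "det D * c\<^sup>2 = det A" "polar A D = 2 * c * det D" unfolding tangent_def by blast
      have "c \<noteq> 0" using c assms by auto
      then have "D = ?f (1 / c, mat c ** D)" using scalar_mult_inverse[of c D] by simp
      moreover have "(1 / c, mat c ** D) \<in> (UNIV - {0}) \<times> ?U"
        using c \<open>c \<noteq> 0\<close> by (auto simp: power2_eq_square algebra_simps)
      ultimately show "D \<in> ?f ` ((UNIV - {0}) \<times> ?U)" by (rule image_eqI)
    qed
  qed
  moreover have "inj_on ?f ((UNIV - {0}) \<times> ?U)"
  proof (rule inj_onI)
    fix x x' :: "'a \<times> ('a^2^2)" assume x: "x \<in> (UNIV - {0}) \<times> ?U" "x' \<in> (UNIV - {0}) \<times> ?U" "?f x = ?f x'"
    obtain k D k' D' where [simp]: "x = (k, D)" "x' = (k', D')" by (cases x, cases x')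
    have k: "k \<noteq> 0" "k' \<noteq> 0" and D: "det D = det A" "polar A D = 2 * det A"
      and D': "det D' = det A" "polar A D' = 2 * det A" and eq: "mat k ** D = mat k' ** D'"
      using x by auto
    have "k\<^sup>2 * det A = k'\<^sup>2 * det A" using arg_cong[OF eq, of det] D D' by simp
    then have "k\<^sup>2 = k'\<^sup>2" using assms by simp
    moreover have "k * (2 * det A) = k' * (2 * det A)" using arg_cong[OF eq, of "polar A"] D D' by simp
    then have "(2 * k) * det A = (2 * k') * det A" by (simp add: mult_ac)
    then have "2 * k = 2 * k'" using mult_right_cancel[OF assms] by blast
    \<comment> \<open>Equal squares leave a sign open in odd characteristic, and
      \<open>2 * k = 2 * k'\<close> is void in characteristic two. Together they give
      \<open>(k - k')\<^sup>2 = (2 * k - 2 * k') * k\<close>, which vanishes.\<close>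
    ultimately have "(k - k')\<^sup>2 = 0" by algebra
    then have "k = k'" by simp
    moreover have "D = D'" using eq k scalar_mult_inverse[of k] \<open>k = k'\<close> by metis
    ultimately show "x = x'" by simp
  qed
  ultimately show ?thesis
    by (simp only: card_image card_cartesian_product card_normalized_tangents[OF assms])
qed

text \<open>With \<open>c\<close> the double root for \<open>A\<close> and \<open>D\<close>, scaling
  \<open>D\<close> by \<open>c\<close> normalises it against \<open>A\<close>. If \<open>d\<close>
  is the double root for \<open>D\<close> and \<open>B\<close>, the scaled matrix lies in
  \<open>common_tangents A B (c * d)\<close>, and \<open>c * d\<close> is a square root of
  \<open>det A / det B\<close>.\<close>

lemma card_tangent_both_le:
  fixes A B :: "'a::{field,finite}^2^2"
  assumes "meets A B" "det A \<noteq> 0" "det B \<noteq> 0" and nonprop: "\<And>k. B \<noteq> mat k ** A"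
  shows "card {D. det D \<noteq> 0 \<and> tangent A D \<and> tangent B D}
    \<le> card (UNIV - {0::'a}) * (CARD('a) * card (square_ratios (det A) (det B)))" (is "card ?T \<le> _")
proof -
  let ?f = "\<lambda>(k, D). mat k ** D :: 'a^2^2" and ?X = "\<lambda>c. (UNIV - {0::'a}) \<times> common_tangents A B c"
  have "?T \<subseteq> (\<Union>c\<in>square_ratios (det A) (det B). ?f ` ?X c)"
  proof
    fix D assume D: "D \<in> ?T"
    then obtain c where c: "det D * c\<^sup>2 = det A" "polar A D = 2 * c * det D" unfolding tangent_def by blast
    have "c \<noteq> 0" using c assms by auto
    obtain d where d: "det B * d\<^sup>2 = det D" "polar D B = 2 * d * det B"
      using D tangent_sym[OF assms(3)] unfolding tangent_def by blast
    have "D = ?f (1 / c, mat c ** D)" using scalar_mult_inverse[of c D] \<open>c \<noteq> 0\<close> by simp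
    moreover have "(1 / c, mat c ** D) \<in> ?X (c * d)"
      using c d \<open>c \<noteq> 0\<close> by (auto simp: common_tangents_def power2_eq_square algebra_simps)
    moreover have "c * d \<in> square_ratios (det A) (det B)"
      using c d by (auto simp: square_ratios_def power2_eq_square algebra_simps)
    ultimately show "D \<in> (\<Union>c\<in>square_ratios (det A) (det B). ?f ` ?X c)" by blast
  qed
  then have "card ?T \<le> card (\<Union>c\<in>square_ratios (det A) (det B). ?f ` ?X c)" by (rule card_mono[rotated]) simp
  also have "\<dots> \<le> (\<Sum>c\<in>square_ratios (det A) (det B). card (?f ` ?X c))" by (rule card_UN_le) simp
  also have "\<dots> \<le> (\<Sum>c\<in>square_ratios (det A) (det B). card (UNIV - {0::'a}) * CARD('a))"
  proof (rule sum_mono)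
    fix c assume "c \<in> square_ratios (det A) (det B)"
    then have "card (common_tangents A B c) \<le> CARD('a)"
      using card_common_tangents_le[OF assms(1-3) _ nonprop] by (simp add: square_ratios_def)
    moreover have "card (?f ` ?X c) \<le> card (?X c)" by (rule card_image_le) simp
    ultimately show "card (?f ` ?X c) \<le> card (UNIV - {0::'a}) * CARD('a)"
      unfolding card_cartesian_product by (meson le_trans mult_le_mono2)
  qed
  also have "\<dots> = card (UNIV - {0::'a}) * (CARD('a) * card (square_ratios (det A) (det B)))"
    by (simp only: sum_constant) (simp add: algebra_simps)
  finally show ?thesis .
qed

lemma card_square_ratios_tangent:
  assumes "det A \<noteq> 0" "tangent A D"
  shows "card (square_ratios x (det D)) = card (square_ratios x (det A))"
proof -
  obtain c where c: "det D * c\<^sup>2 = det A" using assms unfolding tangent_def by blast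
  then have "c \<noteq> 0" using assms by auto
  then show ?thesis using card_square_ratios_square_mult[of c x "det D"] c by simp
qed

section \<open>Second moment of the number of tangent members\<close>

text \<open>\<open>F\<close> holds one matrix for each member of a family in \<open>PGL2\<close>;
  the last assumption keeps the classes of distinct matrices distinct.\<close>

locale meeting_family =
  fixes F :: "('a::{field,finite}^2^2) set"
  assumes det_nonzero: "A \<in> F \<Longrightarrow> det A \<noteq> 0"
    and meets: "A \<in> F \<Longrightarrow> B \<in> F \<Longrightarrow> meets A B"
    and nonproportional: "A \<in> F \<Longrightarrow> B \<in> F \<Longrightarrow> B = mat k ** A \<Longrightarrow> B = A"
begin

text \<open>Over all \<open>D\<close> in \<open>GL2\<close>, the squared deviations of the number \<open>t D\<close> of members tangent to \<open>D\<close> from its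
  approximate mean \<open>M D\<close> sum to at most \<open>(q - 1) q\<^sup>2 |F|\<close>. Tangent matrices have the same determinant up to
  squares, so the mean has to be taken separately for each square class of determinants.\<close>

lemma sum_tangent_le:
  "(\<Sum>A\<in>F. \<Sum>B\<in>F. of_bool (tangent A B) :: real)
    \<le> 2 * (real (card F))\<^sup>2 / real CARD('a) + real CARD('a) * real (card F)"
proof -
  let ?q = "real CARD('a)" and ?n = "real (card F)" and ?GL = "{D::'a^2^2. det D \<noteq> 0}"
    and ?units = "UNIV - {0::'a}"
  have q: "?q > 0" by simp
  have units: "real (card ?units) = ?q - 1" by (rule real_card_nonzero)
  have q1: "?q - 1 > 0"
  proof -
    have "card {0::'a, 1} \<le> CARD('a)" by (rule card_mono) auto
    then show ?thesis by simp
  qed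
  define W where "W A D = (of_bool (tangent A D) :: real)" for A D :: "'a^2^2"
  define e where "e A D = real (card (square_ratios (det A) (det D)))" for A D :: "'a^2^2"
  define t where "t D = (\<Sum>A\<in>F. W A D)" for D
  \<comment> \<open>The matrices tangent to \<open>A\<close> number
    \<open>(q - 1) * q\<^sup>2\<close>, and the weights \<open>e A D\<close> total
    \<open>(q - 1) * q * (q\<^sup>2 - 1)\<close> over \<open>GL2\<close>. So
    \<open>e A D / q\<close> is about the frequency of tangency within the square class.\<close>
  define M where "M D = (\<Sum>A\<in>F. e A D) / ?q" for D
  define S where "S = (\<Sum>A\<in>F. \<Sum>B\<in>F. e A B)"
  have e_nonneg: "e A D \<ge> 0" for A D by (simp add: e_def)
  have swap: "(\<Sum>D\<in>?GL. (\<Sum>A\<in>F. f A D) * (\<Sum>B\<in>F. g B D)) = (\<Sum>A\<in>F. \<Sum>B\<in>F. \<Sum>D\<in>?GL. f A D * g B D)"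
    for f g :: "'a^2^2 \<Rightarrow> 'a^2^2 \<Rightarrow> real"
  proof -
    have "(\<Sum>D\<in>?GL. (\<Sum>A\<in>F. f A D) * (\<Sum>B\<in>F. g B D)) = (\<Sum>D\<in>?GL. \<Sum>A\<in>F. \<Sum>B\<in>F. f A D * g B D)"
      by (simp only: sum_product)
    also have "\<dots> = (\<Sum>A\<in>F. \<Sum>D\<in>?GL. \<Sum>B\<in>F. f A D * g B D)" by (rule sum.swap)
    also have "\<dots> = (\<Sum>A\<in>F. \<Sum>B\<in>F. \<Sum>D\<in>?GL. f A D * g B D)" by (intro sum.cong refl sum.swap)
    finally show ?thesis .
  qed
  have WW: "(\<Sum>D\<in>?GL. W A D * W B D) \<le> (?q - 1) * (?q\<^sup>2 * of_bool (A = B) + ?q * e A B)"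
    if AB: "A \<in> F" "B \<in> F" for A B
  proof -
    have sum: "(\<Sum>D\<in>?GL. W A D * W B D) = real (card {D. det D \<noteq> 0 \<and> tangent A D \<and> tangent B D})"
    proof -
      have "(\<Sum>D\<in>?GL. W A D * W B D) = (\<Sum>D\<in>?GL. of_bool (tangent A D \<and> tangent B D))"
        by (simp add: W_def of_bool_conj)
      also have "\<dots> = real (card {D \<in> ?GL. tangent A D \<and> tangent B D})"
        by (simp add: Int_def)
      finally show ?thesis by simp
    qed
    show ?thesis
    proof (cases "A = B")
      case True
      have "real (card {D. det D \<noteq> 0 \<and> tangent A D}) = (?q - 1) * ?q\<^sup>2"
        using card_tangent[OF det_nonzero[OF AB(1)]] units by simp
      then show ?thesis unfolding sum using True q1 e_nonneg[of A B] by simp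
    next
      case False
      have "card {D. det D \<noteq> 0 \<and> tangent A D \<and> tangent B D}
          \<le> card ?units * (CARD('a) * card (square_ratios (det A) (det B)))"
        by (rule card_tangent_both_le) (use AB False nonproportional[OF AB] det_nonzero meets in metis)+
      then have "real (card {D. det D \<noteq> 0 \<and> tangent A D \<and> tangent B D})
          \<le> real (card ?units * (CARD('a) * card (square_ratios (det A) (det B))))" by (rule of_nat_mono)
      also have "\<dots> = (?q - 1) * (?q * e A B)" by (simp only: of_nat_mult units e_def)
      finally show ?thesis unfolding sum using False by simp
    qed
  qed
  have We: "(\<Sum>D\<in>?GL. W A D * e B D) = (?q - 1) * ?q\<^sup>2 * e A B" if AB: "A \<in> F" "B \<in> F" for A B
  proof -
    \<comment> \<open>Where \<open>W A D\<close> is nonzero, \<open>det D\<close> and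
      \<open>det A\<close> differ by a square, so both have the same weight against
      \<open>B\<close>.\<close>
    have "(\<Sum>D\<in>?GL. W A D * e B D) = (\<Sum>D\<in>?GL. W A D * e B A)"
      using card_square_ratios_tangent[OF det_nonzero[OF AB(1)]] by (intro sum.cong) (auto simp: W_def e_def)
    also have "\<dots> = (\<Sum>D\<in>?GL. W A D) * e B A" by (simp add: sum_distrib_right)
    also have "(\<Sum>D\<in>?GL. W A D) = real (card {D \<in> ?GL. tangent A D})"
      by (simp add: W_def Int_def)
    also have "\<dots> = (?q - 1) * ?q\<^sup>2"
      using card_tangent[OF det_nonzero[OF AB(1)]] units by simp
    also have "e B A = e A B"
      unfolding e_def using card_square_ratios_commute det_nonzero AB by metis
    finally show ?thesis .
  qed
  have ee: "(\<Sum>D\<in>?GL. e A D * e B D) \<le> (?q - 1)\<^sup>2 * (?q * (?q + 1)) * e A B" if AB: "A \<in> F" "B \<in> F" for A B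
  proof -
    let ?f = "\<lambda>z. real (card (square_ratios (det A) z) * card (square_ratios (det B) z))"
    have "(\<Sum>D\<in>?GL. e A D * e B D) = (\<Sum>D\<in>?GL. ?f (det D))" by (simp add: e_def)
    also have "\<dots> = (\<Sum>z\<in>?units. \<Sum>D\<in>{D \<in> ?GL. det D = z}. ?f (det D))"
      by (rule sum.group[symmetric]) auto
    also have "\<dots> = (\<Sum>z\<in>?units. \<Sum>D\<in>{D::'a^2^2. det D = z}. ?f z)"
    proof (rule sum.cong[OF refl])
      fix z :: 'a assume "z \<in> ?units"
      then have "{D \<in> ?GL. det D = z} = {D. det D = z}" by auto
      then show "(\<Sum>D\<in>{D \<in> ?GL. det D = z}. ?f (det D)) = (\<Sum>D\<in>{D::'a^2^2. det D = z}. ?f z)"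
        by (intro sum.cong) auto
    qed
    also have "\<dots> = (\<Sum>z\<in>?units. real (card {D::'a^2^2. det D = z}) * ?f z)" by simp
    also have "\<dots> \<le> (\<Sum>z\<in>?units. ((?q - 1) * (?q * (?q + 1))) * ?f z)"
    proof (intro sum_mono mult_right_mono)
      fix z :: 'a assume "z \<in> ?units"
      then have "real (card {D::'a^2^2. det D = z}) \<le> real (card ?units * (CARD('a) * (CARD('a) + 1)))"
        using card_det_eq_le by (intro of_nat_mono) auto
      also have "\<dots> = (?q - 1) * (?q * (?q + 1))" by (simp only: of_nat_mult of_nat_add of_nat_1 units)
      finally show "real (card {D::'a^2^2. det D = z}) \<le> (?q - 1) * (?q * (?q + 1))" .
    qed simp
    also have "\<dots> = ((?q - 1) * (?q * (?q + 1))) * real (\<Sum>z\<in>?units. card (square_ratios (det A) z) * card (square_ratios (det B) z))"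
      by (simp only: of_nat_sum sum_distrib_left)
    also have "\<dots> \<le> ((?q - 1) * (?q * (?q + 1))) * real (card ?units * card (square_ratios (det A) (det B)))"
      using sum_card_square_ratios_le[OF det_nonzero[OF AB(1)] det_nonzero[OF AB(2)]] q1
      by (intro mult_left_mono of_nat_mono) auto
    also have "\<dots> = (?q - 1)\<^sup>2 * (?q * (?q + 1)) * e A B"
      by (simp only: of_nat_mult units e_def) (simp add: power2_eq_square)
    finally show ?thesis .
  qed
  have S_nonneg: "S \<ge> 0" unfolding S_def using e_nonneg by (intro sum_nonneg) auto
  have "(\<Sum>D\<in>?GL. t D * t D) \<le> (\<Sum>A\<in>F. \<Sum>B\<in>F. (?q - 1) * (?q\<^sup>2 * of_bool (A = B) + ?q * e A B))"
    unfolding t_def swap using WW by (intro sum_mono)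
  also have "\<dots> = (?q - 1) * (?q\<^sup>2 * (\<Sum>A\<in>F. \<Sum>B\<in>F. of_bool (A = B)) + ?q * S)"
    by (simp only: S_def sum.distrib flip: sum_distrib_left)
  also have "(\<Sum>A\<in>F. \<Sum>B\<in>F. of_bool (A = B)) = (\<Sum>A\<in>F. 1 :: real)"
    by (intro sum.cong refl) (simp add: of_bool_def sum.delta)
  finally have tt: "(\<Sum>D\<in>?GL. t D * t D) \<le> (?q - 1) * (?q\<^sup>2 * ?n + ?q * S)" by simp
  have "(\<Sum>D\<in>?GL. t D * (\<Sum>B\<in>F. e B D)) = (\<Sum>A\<in>F. \<Sum>B\<in>F. (?q - 1) * ?q\<^sup>2 * e A B)"
    unfolding t_def swap using We by (intro sum.cong refl)
  also have "\<dots> = (?q - 1) * ?q\<^sup>2 * S" by (simp only: S_def sum_distrib_left)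
  finally have tM: "(\<Sum>D\<in>?GL. t D * M D) = (?q - 1) * ?q * S"
    using q by (simp add: M_def power2_eq_square flip: sum_divide_distrib)
  have "(\<Sum>D\<in>?GL. (\<Sum>A\<in>F. e A D) * (\<Sum>B\<in>F. e B D)) \<le> (\<Sum>A\<in>F. \<Sum>B\<in>F. (?q - 1)\<^sup>2 * (?q * (?q + 1)) * e A B)"
    unfolding swap using ee by (intro sum_mono)
  also have "\<dots> = (?q - 1)\<^sup>2 * (?q * (?q + 1)) * S" by (simp only: S_def sum_distrib_left)
  finally have "(\<Sum>D\<in>?GL. (\<Sum>A\<in>F. e A D) * (\<Sum>B\<in>F. e B D)) / ?q\<^sup>2 \<le> (?q - 1)\<^sup>2 * (?q * (?q + 1)) * S / ?q\<^sup>2"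
    by (rule divide_right_mono) simp
  also have "(\<Sum>D\<in>?GL. (\<Sum>A\<in>F. e A D) * (\<Sum>B\<in>F. e B D)) / ?q\<^sup>2 = (\<Sum>D\<in>?GL. M D * M D)"
    by (simp only: M_def power2_eq_square times_divide_times_eq flip: sum_divide_distrib)
  also have "(?q - 1)\<^sup>2 * (?q * (?q + 1)) * S / ?q\<^sup>2 = (?q - 1) * ((?q - 1 / ?q) * S)"
    using q by (simp add: field_simps power2_eq_square)
  also have "\<dots> \<le> (?q - 1) * (?q * S)"
    using q1 S_nonneg by (intro mult_left_mono mult_right_mono) auto
  finally have MM: "(\<Sum>D\<in>?GL. M D * M D) \<le> (?q - 1) * (?q * S)" .
  have "(\<Sum>D\<in>?GL. (t D - M D)\<^sup>2) = (\<Sum>D\<in>?GL. t D * t D) - 2 * (\<Sum>D\<in>?GL. t D * M D) + (\<Sum>D\<in>?GL. M D * M D)"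
    by (simp add: power2_diff power2_eq_square sum.distrib sum_subtractf sum_distrib_left algebra_simps)
  \<comment> \<open>The terms in \<open>S\<close> have coefficients 1, -2 and 1 times
    \<open>(q - 1) * q\<close> and cancel, which leaves the diagonal part of
    \<open>tt\<close>.\<close>
  also have "\<dots> \<le> (?q - 1) * (?q\<^sup>2 * ?n)"
    using tt tM MM by (simp add: algebra_simps)
  finally have variance: "(\<Sum>D\<in>?GL. (t D - M D)\<^sup>2) \<le> (?q - 1) * (?q\<^sup>2 * ?n)" .
  \<comment> \<open>\<open>t\<close> and \<open>M\<close> are unchanged by nonzero scalars, so each
    member of \<open>F\<close> contributes \<open>q - 1\<close> equal terms to the sum over
    \<open>GL2\<close>, and the factor \<open>q - 1\<close> cancels.\<close>
  let ?g = "\<lambda>(k, A). mat k ** A :: 'a^2^2"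
  have scaled: "t (mat k ** A) = t A" "M (mat k ** A) = M A" if "k \<noteq> 0" for k A
    using that card_square_ratios_square_mult[OF that, of _ "det A"]
    by (simp_all add: t_def M_def W_def e_def tangent_scalar_right mult.commute)
  have "inj_on ?g (?units \<times> F)"
  proof (rule inj_onI)
    fix x x' :: "'a \<times> ('a^2^2)"
    assume x: "x \<in> ?units \<times> F" "x' \<in> ?units \<times> F" and g: "?g x = ?g x'"
    obtain k A k' A' where [simp]: "x = (k, A)" "x' = (k', A')" by (cases x, cases x')
    have k: "k \<noteq> 0" "k' \<noteq> 0" and A: "A \<in> F" "A' \<in> F" using x by auto
    have eq: "mat k ** A = mat k' ** A'" using g by simp
    have "A' = mat (k / k') ** A"
      using eq k by (simp add: matrix2_eq_iff field_simps)
    then have "A' = A" by (rule nonproportional[OF A])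
    have "A \<noteq> 0" using det_nonzero[OF A(1)] by (auto simp: det_2)
    then obtain i j where "A$i$j \<noteq> 0" by (metis vec_eq_iff zero_index)
    moreover have "k * A$i$j = k' * A$i$j"
      using eq \<open>A' = A\<close> by (metis scalar_mult_nth)
    ultimately show "x = x'" using \<open>A' = A\<close> by simp
  qed
  then have "(\<Sum>D\<in>?g ` (?units \<times> F). (t D - M D)\<^sup>2) = (\<Sum>x\<in>?units \<times> F. (t (?g x) - M (?g x))\<^sup>2)"
    by (rule sum.reindex[unfolded comp_def])
  also have "\<dots> = (\<Sum>x\<in>?units \<times> F. (t (snd x) - M (snd x))\<^sup>2)"
  proof (rule sum.cong[OF refl])
    fix x :: "'a \<times> ('a^2^2)" assume "x \<in> ?units \<times> F"
    then have "fst x \<noteq> 0" by auto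
    from scaled[OF this, of "snd x"] show "(t (?g x) - M (?g x))\<^sup>2 = (t (snd x) - M (snd x))\<^sup>2"
      by (simp only: split_def)
  qed
  also have "\<dots> = (\<Sum>k\<in>?units. \<Sum>B\<in>F. (t B - M B)\<^sup>2)"
    by (simp only: sum.cartesian_product split_def)
  also have "\<dots> = (?q - 1) * (\<Sum>B\<in>F. (t B - M B)\<^sup>2)"
    by (simp only: sum_constant units)
  finally have "(?q - 1) * (\<Sum>B\<in>F. (t B - M B)\<^sup>2) = (\<Sum>D\<in>?g ` (?units \<times> F). (t D - M D)\<^sup>2)" ..
  also have "\<dots> \<le> (\<Sum>D\<in>?GL. (t D - M D)\<^sup>2)"
    using det_nonzero by (intro sum_mono2) auto
  also have "\<dots> \<le> (?q - 1) * (?q\<^sup>2 * ?n)" by (rule variance)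
  finally have deviation: "(\<Sum>B\<in>F. (t B - M B)\<^sup>2) \<le> ?q\<^sup>2 * ?n"
    using q1 mult_le_cancel_left_pos by blast
  \<comment> \<open>The mean squared deviation over \<open>F\<close> is at most
    \<open>q\<^sup>2\<close>; the bound \<open>x \<le> (x\<^sup>2 + q\<^sup>2) / (2 * q)\<close>
    turns this into a mean deviation of at most \<open>q\<close>.\<close>
  have "(\<Sum>B\<in>F. t B - M B) \<le> (\<Sum>B\<in>F. ((t B - M B)\<^sup>2 + ?q\<^sup>2) / (2 * ?q))"
  proof (rule sum_mono)
    fix B
    have "2 * (t B - M B) * ?q \<le> (t B - M B)\<^sup>2 + ?q\<^sup>2"
      by (rule sum_squares_bound)
    then show "t B - M B \<le> ((t B - M B)\<^sup>2 + ?q\<^sup>2) / (2 * ?q)"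
      using q by (simp add: pos_le_divide_eq mult.commute mult.left_commute)
  qed
  also have "\<dots> = ((\<Sum>B\<in>F. (t B - M B)\<^sup>2) + ?n * ?q\<^sup>2) / (2 * ?q)"
    by (simp add: sum.distrib flip: sum_divide_distrib)
  also have "\<dots> \<le> (?q\<^sup>2 * ?n + ?n * ?q\<^sup>2) / (2 * ?q)"
    using deviation by (intro divide_right_mono add_right_mono) auto
  also have "\<dots> = ?q * ?n" using q by (simp add: power2_eq_square)
  finally have "(\<Sum>B\<in>F. t B) \<le> (\<Sum>B\<in>F. M B) + ?q * ?n" by (simp add: sum_subtractf)
  also have "(\<Sum>B\<in>F. M B) \<le> (\<Sum>B\<in>F. 2 * ?n / ?q)"
  proof (rule sum_mono)
    fix B assume "B \<in> F"
    then have "e A B \<le> 2" for A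
      using card_scaled_square_le_2[OF det_nonzero, of B "det A"] by (simp add: e_def square_ratios_def)
    then have "(\<Sum>A\<in>F. e A B) \<le> (\<Sum>A\<in>F. 2)" by (intro sum_mono)
    then show "M B \<le> 2 * ?n / ?q" unfolding M_def by (intro divide_right_mono) auto
  qed
  also have "(\<Sum>B\<in>F. 2 * ?n / ?q) = 2 * ?n\<^sup>2 / ?q" by (simp add: power2_eq_square)
  also have "(\<Sum>B\<in>F. t B) = (\<Sum>A\<in>F. \<Sum>B\<in>F. of_bool (tangent A B))"
    unfolding t_def W_def by (rule sum.swap)
  finally show ?thesis by simp
qed

end

section \<open>Agreements\<close>

definition pts :: "('a::field^2) set" where
  "pts = insert (vector [1, 0]) (range (\<lambda>x. vector [x, 1]))"

lemma vector_x_1_inj: "vector [x, 1] = (vector [y, 1] :: 'a::field^2) \<longleftrightarrow> x = y"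
  by (auto simp: vec2_eq_iff)

lemma card_pts: "card (pts :: ('a::{field,finite}^2) set) = CARD('a) + 1"
proof -
  have "(vector [1, 0] :: 'a^2) \<notin> range (\<lambda>x. vector [x, 1])" by (auto simp: vec2_eq_iff)
  moreover have "card (range (\<lambda>x. vector [x, 1] :: 'a^2)) = CARD('a)"
    by (rule card_image) (auto simp: inj_on_def vector_x_1_inj)
  ultimately show ?thesis unfolding pts_def by (subst card_insert_disjoint) auto
qed

lemma pts_nonzero: "v \<in> pts \<Longrightarrow> v \<noteq> 0"
  by (auto simp: pts_def vec2_eq_iff)

lemma cross_commute: "cross v w = - cross w v"
  by (simp add: cross_def)

lemma cross_commute_0: "cross v w = 0 \<longleftrightarrow> cross w v = 0"
  by (subst cross_commute) simp

lemma cross_trans: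
  assumes "w \<noteq> 0" "cross v w = 0" "cross w u = 0" shows "cross v u = 0"
  using assms by (metis cross_eq_0_iff cross_scale(1) mult_zero_right)

lemma ex1_pts:
  fixes v :: "'a::field^2"
  assumes "v \<noteq> 0" shows "\<exists>p. {w \<in> pts. cross v w = 0} = {p}"
proof (cases "v$2 = 0")
  case True
  then have "v$1 \<noteq> 0" using assms by (auto simp: vec2_eq_iff)
  with True have "{w \<in> pts. cross v w = 0} = {vector [1, 0]}"
    by (auto simp: pts_def cross_def)
  then show ?thesis by blast
next
  case False
  then have "{w \<in> pts. cross v w = 0} = {vector [v$1 / v$2, 1]}"
    by (auto simp: pts_def cross_def vector_x_1_inj field_simps)
  then show ?thesis by blast
qed

text \<open>In triangular form, \<open>cross (A *v v) (B *v v)\<close> is \<open>v$2\<close> times a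
  linear form in which \<open>v$1\<close> has coefficient
  \<open>A$1$1 * B$2$2 - B$1$1 * A$2$2\<close>. If this is nonzero there is a second zero
  \<open>vector [x, 1]\<close>; if not, the diagonals are proportional, which is tangency.\<close>

lemma card_common_zeros_ge:
  fixes A B :: "'a::{field,finite}^2^2"
  assumes "meets A B" "det A \<noteq> 0" "det B \<noteq> 0"
  shows "real (card {v \<in> pts. cross (A *v v) (B *v v) = 0}) \<ge> 2 - of_bool (tangent A B)"
proof -
  let ?Z = "{v \<in> pts. cross (A *v v) (B *v v) = 0}"
  have rep: "\<exists>p\<in>?Z. cross u p = 0" if u: "u \<noteq> 0" "cross (A *v u) (B *v u) = 0" for u
  proof -
    obtain p where p: "p \<in> pts" "cross u p = 0" using ex1_pts[OF u(1)] by blast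
    then obtain c where c: "u = c *s p" using cross_eq_0_iff[OF pts_nonzero] by blast
    then have "c \<noteq> 0" using u by auto
    then have "cross (A *v p) (B *v p) = 0" using u(2) c by (simp add: vec.scale)
    with p show ?thesis by blast
  qed
  obtain S R v where SR: "det S \<noteq> 0" "det R \<noteq> 0" and v: "v \<noteq> 0" "R *v vector [1, 0] = v" "cross (A *v v) (B *v v) = 0"
    and tri: "(S ** A ** R)$2$1 = 0" "(S ** B ** R)$2$1 = 0"
    using meets_triangular[OF assms(1,3)] by metis
  obtain p where p: "p \<in> ?Z" "cross v p = 0" using rep[OF v(1,3)] by blast
  show ?thesis
  proof (cases "tangent A B")
    case True
    have "card {p} \<le> card ?Z" using p by (intro card_mono) auto
    with True show ?thesis by simp
  next
    case False
    let ?A = "S ** A ** R" and ?B = "S ** B ** R"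
    have nz: "?A$1$1 \<noteq> 0" "?A$2$2 \<noteq> 0" "?B$1$1 \<noteq> 0" "?B$2$2 \<noteq> 0"
      using det_mult3[of S A R] det_mult3[of S B R] assms SR tri by (auto simp: det_2)
    have "?A$1$1 * ?B$2$2 \<noteq> ?B$1$1 * ?A$2$2"
    proof
      assume eq: "?A$1$1 * ?B$2$2 = ?B$1$1 * ?A$2$2"
      define c where "c = ?A$1$1 / ?B$1$1"
      have c: "?A$1$1 = c * ?B$1$1" "?A$2$2 = c * ?B$2$2"
        using eq nz by (auto simp: c_def field_simps)
      have "det ?B * c\<^sup>2 = det ?A" "polar ?A ?B = 2 * c * det ?B"
        using c tri by (simp_all add: det_2 polar_def power2_eq_square algebra_simps)
      then have "det S * det R * (det B * c\<^sup>2) = det S * det R * det A"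
        "det S * det R * polar A B = det S * det R * (2 * c * det B)"
        by (simp_all add: det_mult3 polar_mult mult_ac)
      then have "det B * c\<^sup>2 = det A" "polar A B = 2 * c * det B" using SR by simp_all
      with False show False unfolding tangent_def by blast
    qed
    then have diff: "?A$1$1 * ?B$2$2 - ?B$1$1 * ?A$2$2 \<noteq> 0" by simp
    define x where "x = (?B$1$2 * ?A$2$2 - ?A$1$2 * ?B$2$2) / (?A$1$1 * ?B$2$2 - ?B$1$1 * ?A$2$2)"
    have x: "(?A$1$1 * ?B$2$2 - ?B$1$1 * ?A$2$2) * x = ?B$1$2 * ?A$2$2 - ?A$1$2 * ?B$2$2"
      using diff by (simp add: x_def)
    define u where "u = R *v vector [x, 1]"
    have "cross (?A *v vector [x, 1]) (?B *v vector [x, 1]) = 0"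
      using x tri by (simp add: cross_def matrix2_mult_vec_nth algebra_simps)
    then have "det S * cross (A *v u) (B *v u) = 0"
      unfolding u_def by (simp add: cross_mult flip: matrix_vector_mul_assoc)
    then have Z: "cross (A *v u) (B *v u) = 0" using SR by simp
    have "cross v u = det R"
      unfolding u_def v(2)[symmetric] cross_mult by (simp add: cross_def)
    then have vu: "cross v u \<noteq> 0" using SR by simp
    then have "u \<noteq> 0" by (auto simp: cross_def)
    then obtain p' where p': "p' \<in> ?Z" "cross u p' = 0" using rep[OF _ Z] by blast
    have "p \<noteq> p'"
    proof
      assume "p = p'"
      then have "cross v u = 0"
        using p p' cross_trans[of p v u] pts_nonzero cross_commute_0 by blast
      with vu show False by simp
    qed
    then have "2 = card {p, p'}" by simp
    also have "\<dots> \<le> card ?Z" using p p' by (intro card_mono) auto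
    finally show ?thesis using False by simp
  qed
qed

context meeting_family
begin

definition fibre :: "'a^2 \<Rightarrow> 'a^2 \<Rightarrow> ('a^2^2) set" where
  "fibre v w = {A \<in> F. cross (A *v v) w = 0}"

lemma sum_card_fibre: "(\<Sum>v\<in>pts. \<Sum>w\<in>pts. real (card (fibre v w))) = (real CARD('a) + 1) * real (card F)"
proof -
  have "(\<Sum>w\<in>pts. real (card (fibre v w))) = real (card F)" if v: "v \<in> pts" for v
  proof -
    have "(\<Sum>w\<in>pts. real (card (fibre v w))) = (\<Sum>w\<in>pts. \<Sum>A\<in>F. of_bool (cross (A *v v) w = 0))"
      by (simp add: fibre_def Int_def)
    also have "\<dots> = (\<Sum>A\<in>F. \<Sum>w\<in>pts. of_bool (cross (A *v v) w = 0))" by (rule sum.swap)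
    also have "\<dots> = (\<Sum>A\<in>F. 1)"
    proof (rule sum.cong[OF refl])
      fix A assume "A \<in> F"
      then have "A *v v \<noteq> 0" using det_nonzero invertible_mult_vec_nonzero pts_nonzero v by blast
      then obtain p where "{w \<in> pts. cross (A *v v) w = 0} = {p}" using ex1_pts by blast
      then show "(\<Sum>w\<in>pts. of_bool (cross (A *v v) w = 0)) = (1 :: real)"
        by (simp add: Int_def)
    qed
    finally show ?thesis by simp
  qed
  then show ?thesis by (simp add: card_pts)
qed

text \<open>Both sides count triples of a point and two members that agree there, on the left sorted
  by the common image.\<close>

lemma sum_card_fibre_square:
  "(\<Sum>v\<in>pts. \<Sum>w\<in>pts. (real (card (fibre v w)))\<^sup>2)
    = (\<Sum>A\<in>F. \<Sum>B\<in>F. real (card {v \<in> pts. cross (A *v v) (B *v v) = 0}))"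
proof -
  have "(\<Sum>v\<in>pts. \<Sum>w\<in>pts. (real (card (fibre v w)))\<^sup>2)
      = (\<Sum>v\<in>pts. \<Sum>w\<in>pts. \<Sum>A\<in>F. \<Sum>B\<in>F. of_bool (cross (A *v v) w = 0 \<and> cross (B *v v) w = 0))"
  proof (intro sum.cong refl)
    fix v w :: "'a^2"
    have "real (card (fibre v w)) = (\<Sum>A\<in>F. of_bool (cross (A *v v) w = 0))"
      by (simp add: fibre_def Int_def)
    then show "(real (card (fibre v w)))\<^sup>2
        = (\<Sum>A\<in>F. \<Sum>B\<in>F. of_bool (cross (A *v v) w = 0 \<and> cross (B *v v) w = 0))"
      by (simp only: power2_eq_square sum_product of_bool_conj)
  qed
  also have "\<dots> = (\<Sum>v\<in>pts. \<Sum>A\<in>F. \<Sum>w\<in>pts. \<Sum>B\<in>F. of_bool (cross (A *v v) w = 0 \<and> cross (B *v v) w = 0))"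
    by (intro sum.cong refl sum.swap)
  also have "\<dots> = (\<Sum>v\<in>pts. \<Sum>A\<in>F. \<Sum>B\<in>F. \<Sum>w\<in>pts. of_bool (cross (A *v v) w = 0 \<and> cross (B *v v) w = 0))"
    by (intro sum.cong refl sum.swap)
  also have "\<dots> = (\<Sum>v\<in>pts. \<Sum>A\<in>F. \<Sum>B\<in>F. of_bool (cross (A *v v) (B *v v) = 0))"
  proof (intro sum.cong refl)
    fix v :: "'a^2" and A B assume "v \<in> pts" "A \<in> F" "B \<in> F"
    then have nz: "A *v v \<noteq> 0" "B *v v \<noteq> 0"
      using det_nonzero invertible_mult_vec_nonzero pts_nonzero by blast+
    obtain p where p: "{w \<in> pts. cross (A *v v) w = 0} = {p}" using ex1_pts[OF nz(1)] by blast
    have "cross (B *v v) w = 0 \<longleftrightarrow> cross (A *v v) (B *v v) = 0" if "w \<in> pts" "cross (A *v v) w = 0" for w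
      using cross_trans[OF pts_nonzero[OF that(1)] that(2)] cross_trans[OF nz(1) _ that(2)]
        cross_commute_0 by metis
    then have "{w \<in> pts. cross (A *v v) w = 0 \<and> cross (B *v v) w = 0}
        = (if cross (A *v v) (B *v v) = 0 then {w \<in> pts. cross (A *v v) w = 0} else {})"
      by auto
    then have "card {w \<in> pts. cross (A *v v) w = 0 \<and> cross (B *v v) w = 0} = of_bool (cross (A *v v) (B *v v) = 0)"
      using p by simp
    then show "(\<Sum>w\<in>pts. of_bool (cross (A *v v) w = 0 \<and> cross (B *v v) w = 0))
        = (of_bool (cross (A *v v) (B *v v) = 0) :: real)"
      by (simp add: Int_def)
  qed
  also have "\<dots> = (\<Sum>A\<in>F. \<Sum>v\<in>pts. \<Sum>B\<in>F. of_bool (cross (A *v v) (B *v v) = 0))" by (rule sum.swap)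
  also have "\<dots> = (\<Sum>A\<in>F. \<Sum>B\<in>F. \<Sum>v\<in>pts. of_bool (cross (A *v v) (B *v v) = 0))"
    by (intro sum.cong refl sum.swap)
  finally show ?thesis by (simp add: Int_def)
qed

text \<open>With \<open>m\<close> the largest fibre size, the sum of the squared sizes is at most
  \<open>m\<close> times the sum of the sizes, \<open>m * (q + 1) * n\<close>. By
  \<open>card_common_zeros_ge\<close> it is at least \<open>2 * n\<^sup>2\<close> minus the number
  of tangent pairs.\<close>

lemma ex_large_fibre:
  assumes "F \<noteq> {}"
  obtains v w where "v \<in> pts" "w \<in> pts"
    "2 * real (card F) - 2 * real (card F) / real CARD('a) - real CARD('a)
      \<le> (real CARD('a) + 1) * real (card (fibre v w))"
proof -
  let ?q = "real CARD('a)" and ?n = "real (card F)" and ?N = "\<lambda>(v, w). card (fibre v w)"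
  define m where "m = Max (?N ` (pts \<times> pts))"
  have fin: "finite (?N ` (pts \<times> pts))" by simp
  have "pts \<noteq> ({} :: ('a^2) set)" by (simp add: pts_def)
  then have "m \<in> ?N ` (pts \<times> pts)" unfolding m_def using fin by (intro Max_in) auto
  then obtain v w where vw: "v \<in> pts" "w \<in> pts" "m = card (fibre v w)" by auto
  have max: "card (fibre v w) \<le> m" if "v \<in> pts" "w \<in> pts" for v w
    unfolding m_def using that fin by (intro Max_ge) auto
  have "2 * ?n\<^sup>2 - (\<Sum>A\<in>F. \<Sum>B\<in>F. of_bool (tangent A B)) = (\<Sum>A\<in>F. \<Sum>B\<in>F. 2 - of_bool (tangent A B))"
    by (simp add: sum_subtractf power2_eq_square del: sum_of_bool_eq)
  also have "\<dots> \<le> (\<Sum>A\<in>F. \<Sum>B\<in>F. real (card {v \<in> pts. cross (A *v v) (B *v v) = 0}))"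
    by (intro sum_mono card_common_zeros_ge meets det_nonzero)
  also have "\<dots> = (\<Sum>v\<in>pts. \<Sum>w\<in>pts. (real (card (fibre v w)))\<^sup>2)" by (rule sum_card_fibre_square[symmetric])
  also have "\<dots> \<le> (\<Sum>v\<in>pts. \<Sum>w\<in>pts. real m * real (card (fibre v w)))"
    using max by (intro sum_mono) (auto simp: power2_eq_square intro!: mult_right_mono)
  also have "\<dots> = real m * ((?q + 1) * ?n)"
    unfolding sum_card_fibre[symmetric] by (simp only: sum_distrib_left)
  finally have "?n * (2 * ?n - 2 * ?n / ?q - ?q) \<le> ?n * ((?q + 1) * real m)"
    using sum_tangent_le by (simp add: algebra_simps power2_eq_square)
  moreover have "?n > 0" using assms by (simp add: card_gt_0_iff)
  ultimately have "2 * ?n - 2 * ?n / ?q - ?q \<le> (?q + 1) * real m"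
    using mult_le_cancel_left_pos by blast
  then show ?thesis using vw by (intro that[of v w]) auto
qed

end

section \<open>Numerical estimates for the size of a fibre\<close>

lemma sqrt_2_le: "sqrt 2 \<le> 3 / 2"
  by (rule real_le_lsqrt) (simp_all add: power2_eq_square)

text \<open>For \<open>n\<close> about \<open>q\<^sup>2 / sqrt 2\<close> the ratio
  \<open>2 * n / q\<close> is about \<open>sqrt 2 * q\<close>; the lower-order terms of the
  threshold absorb the errors.\<close>

lemma large_fibre_lower_bound:
  fixes q n m :: real
  assumes q: "q \<ge> 2" and n: "n \<ge> 1 / sqrt 2 * q\<^sup>2 + 2 * sqrt 2 * q + 8"
    and m: "2 * n - 2 * n / q - q \<le> (q + 1) * m"
  shows "m \<ge> sqrt 2 * q + 1"
proof -
  define s where "s = sqrt 2"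
  have s: "s * s = 2" "s \<ge> 1" "s \<le> 3/2" "1 / s = s / 2"
    using sqrt_2_le by (auto simp: s_def field_simps)
  have "(q + 1) * (s * q + 1) * q \<le> (q + 1) * m * q"
  proof -
    have "(15 - 4 * s) * 2 \<le> (15 - 4 * s) * q" by (rule mult_left_mono) (use s(3) q in auto)
    moreover have "16 \<le> (15 - 4 * s) * 2" using s(3) by simp
    ultimately have "0 + 16 \<le> (2 * s - 2) * q\<^sup>2 + (15 - 4 * s) * q"
      by (intro add_mono) (use s(2) in auto)
    then have "0 \<le> (2 * s - 2) * q\<^sup>2 + (15 - 4 * s) * q - 16" by (simp only: add_0_left diff_ge_0_iff_ge)
    also have "\<dots> = 2 * (q - 1) * (s / 2 * q\<^sup>2 + 2 * s * q + 8) - q\<^sup>2 - (q + 1) * (s * q + 1) * q"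
      by (simp add: field_simps power2_eq_square)
    finally have "(q + 1) * (s * q + 1) * q \<le> 2 * (q - 1) * (s / 2 * q\<^sup>2 + 2 * s * q + 8) - q\<^sup>2"
      by (simp only: diff_ge_0_iff_ge)
    also have "\<dots> \<le> 2 * (q - 1) * n - q\<^sup>2"
      using n q unfolding s_def[symmetric] s(4) by (intro diff_right_mono mult_left_mono) auto
    also have "\<dots> = (2 * n - 2 * n / q - q) * q" using q by (simp add: field_simps power2_eq_square)
    also have "\<dots> \<le> (q + 1) * m * q" using m q by (intro mult_right_mono) auto
    finally show ?thesis .
  qed
  then show ?thesis using q unfolding s_def by (simp add: mult.commute)
qed

text \<open>The difference of the two sides is concave in \<open>m\<close>, so between
  \<open>m0\<close> and \<open>m1\<close> it lies above the chord through the endpoints. The chord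
  has nonnegative slope, hence its value at \<open>m0\<close> decides.\<close>

lemma no_intermediate_fibre_size:
  fixes q n m :: real
  assumes q: "q \<ge> 2" and n: "n \<ge> 1 / sqrt 2 * q\<^sup>2 + 2 * sqrt 2 * q + 8"
    and m: "m \<ge> sqrt 2 * q + 1" "2 * m \<le> q * (q - 1)"
  shows "(n - m) * m > (q - 1) * (q\<^sup>2 + m)"
proof -
  define s where "s = sqrt 2"
  have s: "s * s = 2" "s \<ge> 1" "s \<le> 3/2" "1 / s = s / 2"
    using sqrt_2_le by (auto simp: s_def field_simps)
  define m0 m1 where "m0 = s * q + 1" and "m1 = q * (q - 1) / 2"
  have n': "n \<ge> s / 2 * q\<^sup>2 + 2 * s * q + 8" using n unfolding s_def[symmetric] s(4) .
  have m': "m0 \<le> m" "m \<le> m1" using m by (auto simp: m0_def m1_def s_def)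
  have "(m - m0) * (m1 - m) \<ge> 0" using m' by simp
  then have "(n - m) * m - (q - 1) * (q\<^sup>2 + m) \<ge> m * (n - m0 - m1 - (q - 1)) + m0 * m1 - (q - 1) * q\<^sup>2"
    by (simp add: algebra_simps)
  moreover have "m * (n - m0 - m1 - (q - 1)) \<ge> m0 * (n - m0 - m1 - (q - 1))"
  proof (rule mult_right_mono[OF m'(1)])
    have "n - m0 - m1 - (q - 1) \<ge> (s - 1) / 2 * q\<^sup>2 + (s - 1 / 2) * q + 8"
      using n' unfolding m0_def m1_def by (simp add: field_simps power2_eq_square)
    moreover have "(s - 1) / 2 * q\<^sup>2 \<ge> 0" "(s - 1 / 2) * q \<ge> 0" using s q by auto
    ultimately show "0 \<le> n - m0 - m1 - (q - 1)" by linarith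
  qed
  moreover have "m0 * (n - m0 - (q - 1)) \<ge> m0 * (s / 2 * q\<^sup>2 + (s - 1) * q + 8)"
  proof (rule mult_left_mono)
    show "s / 2 * q\<^sup>2 + (s - 1) * q + 8 \<le> n - m0 - (q - 1)"
      using n' unfolding m0_def by (simp add: algebra_simps)
    show "0 \<le> m0" using s q by (simp add: m0_def)
  qed
  \<comment> \<open>The cubic terms cancel because \<open>s * (s / 2) = 1\<close>. This balance is
    what fixes the constant \<open>1 / sqrt 2\<close>.\<close>
  moreover have "m0 * (s / 2 * q\<^sup>2 + (s - 1) * q + 8) - (q - 1) * q\<^sup>2
      = (3 - s / 2) * q\<^sup>2 + (9 * s - 1) * q + 8"
  proof -
    have "s * (s * x) = 2 * x" for x using s(1) by (simp flip: mult.assoc)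
    then show ?thesis using s(1) unfolding m0_def by (simp add: field_simps power2_eq_square)
  qed
  moreover have "(3 - s / 2) * q\<^sup>2 \<ge> 0" "(9 * s - 1) * q \<ge> 0" using s q by auto
  moreover have "m0 * (n - m0 - m1 - (q - 1)) + m0 * m1 = m0 * (n - m0 - (q - 1))"
    by (simp add: algebra_simps)
  ultimately show ?thesis by linarith
qed

section \<open>Affine coordinates for a fibre and its complement\<close>

context meeting_family
begin

text \<open>A base change taking \<open>v\<close> and \<open>w\<close> to infinity makes the fibre a
  set of triangular matrices, that is of affine maps; all other members get a nonzero lower left
  entry. Dividing by the lower right or the lower left entry gives the coordinates
  \<open>line\<close> and \<open>conic\<close>, to which the counts for \<open>misses\<close>
  apply.\<close>

lemma fibre_bounds:
  assumes "v \<noteq> 0" "w \<noteq> 0"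
  shows "real (card (F - fibre v w)) * real (card (fibre v w))
      \<le> (real CARD('a) - 1) * ((real CARD('a))\<^sup>2 + real (card (fibre v w)))"
    and "F - fibre v w \<noteq> {} \<Longrightarrow> 2 * real (card (fibre v w)) \<le> real CARD('a) * (real CARD('a) - 1)"
proof -
  obtain S R where SR: "det S \<noteq> 0" "det R \<noteq> 0"
    and low: "\<And>A. (S ** A ** R)$2$1 = - cross (A *v v) w"
    using triangularize[OF assms] by metis
  define T where "T A = S ** A ** R" for A
  define line where "line A = (T A$1$1 / T A$2$2, T A$1$2 / T A$2$2)" for A
  define conic where "conic A = (T A$1$1 / T A$2$1, T A$1$2 / T A$2$1, T A$2$2 / T A$2$1)" for A
  have mem: "A \<in> fibre v w \<longleftrightarrow> A \<in> F \<and> T A$2$1 = 0" for A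
    by (simp add: fibre_def T_def low)
  have det: "T A$1$1 * T A$2$2 - T A$1$2 * T A$2$1 \<noteq> 0" if "A \<in> F" for A
    using det_nonzero[OF that] SR det_mult3[of S A R] by (simp add: T_def det_2)
  have diag: "T A$1$1 \<noteq> 0" "T A$2$2 \<noteq> 0" if "A \<in> fibre v w" for A
    using that det[of A] by (auto simp: mem)
  have eq: "A = B" if "A \<in> F" "B \<in> F" "T B = mat k ** T A" for A B k
  proof -
    have "S ** B ** R = S ** (mat k ** A) ** R"
      using that(3) unfolding T_def by (metis mat_mult_commute matrix_mul_assoc)
    then have "B = mat k ** A" using mult_invertible_right_cancel SR by metis
    then show ?thesis using nonproportional that by metis
  qed
  have quot: "y = b / a * x" if "a \<noteq> 0" "b \<noteq> 0" "x / a = y / b" for x y a b :: 'a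
    using that by (simp add: field_simps)
  have inj_line: "inj_on line (fibre v w)"
  proof (rule inj_onI)
    fix A B assume AB: "A \<in> fibre v w" "B \<in> fibre v w" and f: "line A = line B"
    have "T A$1$1 / T A$2$2 = T B$1$1 / T B$2$2" "T A$1$2 / T A$2$2 = T B$1$2 / T B$2$2"
      using f by (simp_all add: line_def)
    then have "T B$1$1 = T B$2$2 / T A$2$2 * T A$1$1" "T B$1$2 = T B$2$2 / T A$2$2 * T A$1$2"
      using diag[OF AB(1)] diag[OF AB(2)] by (blast intro: quot)+
    then have "T B = mat (T B$2$2 / T A$2$2) ** T A"
      using diag[OF AB(1)] AB by (simp add: matrix2_eq_iff mem)
    moreover have "A \<in> F" "B \<in> F" using AB by (auto simp: mem)
    ultimately show "A = B" using eq by blast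
  qed
  have inj_conic: "inj_on conic (F - fibre v w)"
  proof (rule inj_onI)
    fix A B assume AB: "A \<in> F - fibre v w" "B \<in> F - fibre v w" and f: "conic A = conic B"
    then have nz: "T A$2$1 \<noteq> 0" "T B$2$1 \<noteq> 0" by (auto simp: mem)
    have "T A$1$1 / T A$2$1 = T B$1$1 / T B$2$1" "T A$1$2 / T A$2$1 = T B$1$2 / T B$2$1"
      "T A$2$2 / T A$2$1 = T B$2$2 / T B$2$1"
      using f by (simp_all add: conic_def)
    then have "T B$1$1 = T B$2$1 / T A$2$1 * T A$1$1" "T B$1$2 = T B$2$1 / T A$2$1 * T A$1$2"
      "T B$2$2 = T B$2$1 / T A$2$1 * T A$2$2"
      using nz by (blast intro: quot)+
    then have "T B = mat (T B$2$1 / T A$2$1) ** T A"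
      using nz by (simp add: matrix2_eq_iff)
    moreover have "A \<in> F" "B \<in> F" using AB by auto
    ultimately show "A = B" using eq by blast
  qed
  have meet: "\<not> misses (line A) (conic B)" if A: "A \<in> fibre v w" and B: "B \<in> F - fibre v w" for A B
  proof -
    have nz: "T A$2$1 = 0" "T A$1$1 \<noteq> 0" "T A$2$2 \<noteq> 0" "T B$2$1 \<noteq> 0"
      using A B diag by (auto simp: mem)
    have "meets (T A) (T B)" unfolding T_def using A B SR by (intro meets_mult meets) (auto simp: mem)
    then obtain u where u: "u \<noteq> 0" "cross (T A *v u) (T B *v u) = 0" unfolding meets_def by blast
    have c: "(T A$1$1 * u$1 + T A$1$2 * u$2) * (T B$2$1 * u$1 + T B$2$2 * u$2)
        = T A$2$2 * u$2 * (T B$1$1 * u$1 + T B$1$2 * u$2)"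
      using u(2) nz by (simp add: cross_def matrix2_mult_vec_nth)
    \<comment> \<open>The point of agreement is not infinity: \<open>T A\<close> fixes infinity and
      \<open>T B\<close> does not.\<close>
    have u2: "u$2 \<noteq> 0"
    proof
      assume "u$2 = 0"
      moreover from this have "u$1 \<noteq> 0" using u(1) by (auto simp: vec2_eq_iff)
      ultimately show False using c nz by simp
    qed
    define x where "x = u$1 / u$2"
    have u1: "u$1 = x * u$2" using u2 by (simp add: x_def)
    have "(u$2)\<^sup>2 * ((T A$1$1 * x + T A$1$2) * (T B$2$1 * x + T B$2$2))
        = (u$2)\<^sup>2 * (T A$2$2 * (T B$1$1 * x + T B$1$2))"
      using c unfolding u1 by (simp add: power2_eq_square algebra_simps)
    then have c': "(T A$1$1 * x + T A$1$2) * (T B$2$1 * x + T B$2$2) = T A$2$2 * (T B$1$1 * x + T B$1$2)"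
      using u2 by simp
    define \<alpha> \<beta> a b d where defs: "\<alpha> = T A$1$1 / T A$2$2" "\<beta> = T A$1$2 / T A$2$2"
      "a = T B$1$1 / T B$2$1" "b = T B$1$2 / T B$2$1" "d = T B$2$2 / T B$2$1"
    have "T A$1$1 = \<alpha> * T A$2$2" "T A$1$2 = \<beta> * T A$2$2"
      "T B$1$1 = a * T B$2$1" "T B$1$2 = b * T B$2$1" "T B$2$2 = d * T B$2$1"
      using nz by (simp_all add: defs)
    then have "T A$2$2 * T B$2$1 * ((\<alpha> * x + \<beta>) * (x + d)) = T A$2$2 * T B$2$1 * (a * x + b)"
      using c' by (simp add: algebra_simps)
    then have "(\<alpha> * x + \<beta>) * (x + d) = a * x + b" using nz by simp
    then have "\<alpha> * x\<^sup>2 + (\<beta> + \<alpha> * d - a) * x + (\<beta> * d - b) = 0"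
      by (simp add: power2_eq_square algebra_simps)
    then show ?thesis unfolding line_def conic_def misses_def rootless_def by (auto simp flip: defs)
  qed
  have nonsing: "a * d \<noteq> b" if "(a, b, d) = conic B" "B \<in> F - fibre v w" for a b d B
  proof
    assume "a * d = b"
    moreover have "T B$2$1 \<noteq> 0" "B \<in> F" using that by (auto simp: mem)
    moreover from this have "T B$1$1 = a * T B$2$1" "T B$1$2 = b * T B$2$1" "T B$2$2 = d * T B$2$1"
      using that by (simp_all add: conic_def)
    ultimately show False using det[of B] by (simp add: mult_ac)
  qed
  have "real (card (conic ` (F - fibre v w))) * real (card (line ` fibre v w))
      \<le> (real CARD('a) - 1) * ((real CARD('a))\<^sup>2 + real (card (line ` fibre v w)))"
  proof (rule card_cross_intersecting_le)
    show "\<alpha> \<noteq> 0" if "(\<alpha>, \<beta>) \<in> line ` fibre v w" for \<alpha> \<beta>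
      using that diag by (auto simp: line_def)
    show "a * d \<noteq> b" if "(a, b, d) \<in> conic ` (F - fibre v w)" for a b d
      using that nonsing by blast
    show "\<not> misses l D" if "l \<in> line ` fibre v w" "D \<in> conic ` (F - fibre v w)" for l D
      using that meet by blast
  qed
  then show "real (card (F - fibre v w)) * real (card (fibre v w))
      \<le> (real CARD('a) - 1) * ((real CARD('a))\<^sup>2 + real (card (fibre v w)))"
    by (simp only: card_image[OF inj_line] card_image[OF inj_conic])
  assume "F - fibre v w \<noteq> {}"
  then obtain B where B: "B \<in> F - fibre v w" by blast
  obtain a b d where abd: "conic B = (a, b, d)" by (metis prod_cases3)
  have "2 * real (card (line ` fibre v w)) \<le> real CARD('a) * (real CARD('a) - 1)"
  proof (rule card_lines_meeting_le)
    show "\<alpha> \<noteq> 0" if "(\<alpha>, \<beta>) \<in> line ` fibre v w" for \<alpha> \<beta>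
      using that diag by (auto simp: line_def)
    show "a * d \<noteq> b" using nonsing[OF abd[symmetric] B] .
    show "\<not> misses l (a, b, d)" if "l \<in> line ` fibre v w" for l
      using that meet[OF _ B] abd by auto
  qed
  then show "2 * real (card (fibre v w)) \<le> real CARD('a) * (real CARD('a) - 1)"
    by (simp only: card_image[OF inj_line])
qed

text \<open>If a member lay outside the fibre of \<open>ex_large_fibre\<close>, the size of that
  fibre would be in the range excluded by \<open>no_intermediate_fibre_size\<close>.\<close>

lemma ex_common_fibre:
  assumes "real (card F) \<ge> 1 / sqrt 2 * (real CARD('a))\<^sup>2 + 2 * sqrt 2 * real CARD('a) + 8"
  obtains v w where "v \<noteq> 0" "w \<noteq> 0" "fibre v w = F"
proof -
  let ?q = "real CARD('a)" and ?n = "real (card F)"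
  have q: "?q \<ge> 2"
  proof -
    have "card {0::'a, 1} \<le> CARD('a)" by (rule card_mono) auto
    then show ?thesis by simp
  qed
  have "1 / sqrt 2 * ?q\<^sup>2 + 2 * sqrt 2 * ?q + 8 > 0" by (intro add_nonneg_pos) auto
  then have "F \<noteq> {}" using assms by auto
  then obtain v w where vw: "v \<in> pts" "w \<in> pts"
    and large: "2 * ?n - 2 * ?n / ?q - ?q \<le> (?q + 1) * real (card (fibre v w))"
    by (rule ex_large_fibre)
  let ?m = "real (card (fibre v w))"
  have nz: "v \<noteq> 0" "w \<noteq> 0" using vw pts_nonzero by auto
  have m: "?m \<ge> sqrt 2 * ?q + 1" by (rule large_fibre_lower_bound[OF q assms large])
  have sub: "fibre v w \<subseteq> F" by (auto simp: fibre_def)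
  have "F - fibre v w = {}"
  proof (rule ccontr)
    assume ne: "F - fibre v w \<noteq> {}"
    have "card (F - fibre v w) = card F - card (fibre v w)" "card (fibre v w) \<le> card F"
      using sub by (auto intro: card_Diff_subset card_mono)
    then have "real (card (F - fibre v w)) = ?n - ?m" by (simp add: of_nat_diff)
    then have "(?n - ?m) * ?m \<le> (?q - 1) * (?q\<^sup>2 + ?m)" using fibre_bounds(1)[OF nz] by simp
    with no_intermediate_fibre_size[OF q assms m fibre_bounds(2)[OF nz ne]] show False by linarith
  qed
  with sub nz show ?thesis by (intro that[of v w]) auto
qed

end

section \<open>Matrix representatives of PGL2\<close>

definition pclass :: "'a::field^2^2 \<Rightarrow> ('a^2^2) set" where
  "pclass A = scalar_matrices #>\<^bsub>GL2\<^esub> A"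

lemma pclass_eq: "pclass A = {mat c ** A | c. c \<noteq> 0}"
  by (auto simp: pclass_def r_coset_def scalar_matrices_def GL2_def)

lemma carrier_PGL2: "carrier PGL2 = pclass ` {A::'a::field^2^2. det A \<noteq> 0}"
  by (auto simp: PGL2_def FactGroup_def RCOSETS_def pclass_def GL2_def invertible_det_nz)

lemma pclass_mult:
  fixes A B :: "'a::field^2^2"
  assumes "det A \<noteq> 0" "det B \<noteq> 0"
  shows "pclass A \<otimes>\<^bsub>PGL2\<^esub> pclass B = pclass (A ** B)"
  using normal.rcos_sum[OF normal_scalar_matrices, of A B] assms
  by (simp add: PGL2_def pclass_def) (simp add: GL2_def invertible_det_nz)

lemma pclass_self: "A \<in> pclass A"
  unfolding pclass_eq by (auto intro!: exI[of _ 1])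

lemma pclass_scalar_mult:
  assumes "k \<noteq> 0" shows "pclass (mat k ** A) = pclass A"
proof (intro equalityI subsetI)
  fix X assume "X \<in> pclass (mat k ** A)"
  then obtain c where "c \<noteq> 0" "X = mat (c * k) ** A"
    by (auto simp: pclass_eq mat_mult_mat matrix_mul_assoc)
  with assms show "X \<in> pclass A" unfolding pclass_eq by auto
next
  fix X assume "X \<in> pclass A"
  then obtain c where c: "c \<noteq> 0" "X = mat c ** A" by (auto simp: pclass_eq)
  then have "X = mat (c / k) ** (mat k ** A)"
    using assms by (simp add: mat_mult_mat matrix_mul_assoc)
  moreover have "c / k \<noteq> 0" using c assms by simp
  ultimately show "X \<in> pclass (mat k ** A)" unfolding pclass_eq by blast
qed

lemma pclass_eqD: "pclass A = pclass B \<Longrightarrow> \<exists>c. c \<noteq> 0 \<and> A = mat c ** B"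
  using pclass_self[of A] unfolding pclass_eq[of B] by auto

lemma action_pclass: "vec.subspace P \<Longrightarrow> PGL2_action (pclass A) P = (*v) A ` P"
  unfolding pclass_def by (rule PGL2_action_rep)

lemma PG1_iff: "P \<in> PG1 \<longleftrightarrow> (\<exists>v::'a::field^2. v \<noteq> 0 \<and> P = range (\<lambda>k. k *s v))"
proof
  assume "P \<in> PG1"
  then have P: "vec.subspace P" "vec.dim P = 1" by (auto simp: PG1_def)
  obtain B where B: "B \<subseteq> P" "vec.independent B" "P \<subseteq> vec.span B" "card B = vec.dim P"
    using vec.basis_exists by blast
  then obtain v where v: "B = {v}" using P by (auto simp: card_1_singleton_iff)
  then have "v \<noteq> 0" using B by simp
  moreover have "P = vec.span {v}" using B v P vec.span_minimal by blast
  ultimately show "\<exists>v. v \<noteq> 0 \<and> P = range (\<lambda>k. k *s v)" by (auto simp: vec.span_singleton)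
next
  assume "\<exists>v. v \<noteq> 0 \<and> P = range (\<lambda>k. k *s v)"
  then obtain v where v: "v \<noteq> 0" "P = vec.span {v}" by (auto simp: vec.span_singleton)
  then have "vec.dim P = 1" using vec.dim_span_eq_card_independent[of "{v}"] by simp
  then show "P \<in> PG1" using v by (simp add: PG1_def vec.subspace_span)
qed

section \<open>Transfer from matrices to cosets of point stabilisers\<close>

theorem corollary6p6:
  fixes F :: "('a::{field,finite}^2^2) set set" and q :: nat
  assumes "q = CARD('a)"
    and "intersecting_family F"
    and "real (card F) \<ge> 1 / sqrt 2 * (real q)\<^sup>2 + 2 * sqrt 2 * real q + 8"
  shows "\<exists>P\<in>PG1. \<exists>g\<in>carrier PGL2.
           F \<subseteq> g <#\<^bsub>PGL2\<^esub> stabilizer PGL2 PGL2_action P"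
proof -
  have F: "F \<subseteq> carrier PGL2" using assms(2) by (simp add: intersecting_family_def)
  define rep where "rep M = (SOME A::'a^2^2. det A \<noteq> 0 \<and> M = pclass A)" for M
  have rep: "det (rep M) \<noteq> 0" "pclass (rep M) = M" if "M \<in> F" for M
  proof -
    have "\<exists>A::'a^2^2. det A \<noteq> 0 \<and> M = pclass A" using that F by (auto simp: carrier_PGL2)
    then have "det (rep M) \<noteq> 0 \<and> M = pclass (rep M)" unfolding rep_def by (rule someI_ex)
    then show "det (rep M) \<noteq> 0" "pclass (rep M) = M" by auto
  qed
  interpret meeting_family "rep ` F"
  proof
    show "det A \<noteq> 0" if "A \<in> rep ` F" for A using that rep by auto
    show "meets A B" if AB: "A \<in> rep ` F" "B \<in> rep ` F" for A B
    proof -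
      obtain M N where M: "A = rep M" "B = rep N" "M \<in> F" "N \<in> F" using AB by blast
      then obtain P where P: "P \<in> PG1" "PGL2_action M P = PGL2_action N P"
        using assms(2) unfolding intersecting_family_def by blast
      then have eq: "(*v) A ` P = (*v) B ` P"
        using rep[OF M(3)] rep[OF M(4)] M action_pclass[of P A] action_pclass[of P B]
        by (simp add: PG1_def)
      obtain v where v: "v \<noteq> 0" "P = range (\<lambda>k. k *s v)" using P(1) PG1_iff by blast
      have "v = 1 *s v" by simp
      then have "v \<in> P" unfolding v(2) by (rule range_eqI)
      then have "A *v v \<in> (*v) B ` P" unfolding eq[symmetric] by (rule imageI)
      then obtain k where "A *v v = B *v (k *s v)" unfolding v(2) by auto
      then have "cross (A *v v) (B *v v) = 0" by (simp add: vec.scale)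
      with v show "meets A B" unfolding meets_def by blast
    qed
    show "B = A" if AB: "A \<in> rep ` F" "B \<in> rep ` F" and B: "B = mat k ** A" for A B k
    proof -
      obtain M N where M: "A = rep M" "B = rep N" "M \<in> F" "N \<in> F" using AB by blast
      have "k \<noteq> 0" using rep(1)[OF M(4)] B M by auto
      then have "pclass B = pclass A" using B pclass_scalar_mult by simp
      then show "B = A" using rep(2) M by metis
    qed
  qed
  have "inj_on rep F" using rep(2) by (metis inj_onI)
  then have "card (rep ` F) = card F" by (rule card_image)
  then have "real (card (rep ` F)) \<ge> 1 / sqrt 2 * (real CARD('a))\<^sup>2 + 2 * sqrt 2 * real CARD('a) + 8"
    using assms by simp
  then obtain v w where nz: "v \<noteq> 0" "w \<noteq> 0" and "fibre v w = rep ` F" by (rule ex_common_fibre)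
  then have fib: "cross (rep M *v v) w = 0" if "M \<in> F" for M
    using that by (auto simp: fibre_def)
  define P where "P = range (\<lambda>k. k *s v)"
  have P: "P \<in> PG1" using nz PG1_iff unfolding P_def by blast
  then have sub: "vec.subspace P" by (simp add: PG1_def)
  have "0 < 1 / sqrt 2 * (real q)\<^sup>2 + 2 * sqrt 2 * real q + 8" by (intro add_nonneg_pos) auto
  then have "F \<noteq> {}" using assms(3) by auto
  \<comment> \<open>Any member serves as coset representative: all members map \<open>P\<close> to
    the line of \<open>w\<close>, so \<open>g\<close> and \<open>M\<close> differ by an element
    fixing \<open>P\<close>.\<close>
  then obtain g where g: "g \<in> F" by blast
  interpret PGL: group "PGL2 :: ('a^2^2) set monoid" by (rule group_PGL2)
  have "M \<in> g <#\<^bsub>PGL2\<^esub> stabilizer PGL2 PGL2_action P" if M: "M \<in> F" for M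
  proof -
    have carr: "g \<in> carrier PGL2" "M \<in> carrier PGL2" using F g M by auto
    define h where "h = inv\<^bsub>PGL2\<^esub> g \<otimes>\<^bsub>PGL2\<^esub> M"
    have h: "h \<in> carrier PGL2" "g \<otimes>\<^bsub>PGL2\<^esub> h = M"
      using carr by (auto simp: h_def PGL.m_assoc[symmetric])
    then obtain C where C: "h = pclass C" "det C \<noteq> 0" by (auto simp: carrier_PGL2)
    have "pclass (rep g ** C) = pclass (rep M)"
      using h(2) pclass_mult[OF rep(1)[OF g] C(2)] rep(2)[OF g] rep(2)[OF M] C by simp
    then obtain c where c: "rep g ** C = mat c ** rep M" using pclass_eqD by blast
    have "rep g *v (C *v v) = c *s (rep M *v v)"
      using c by (metis matrix_vector_mul_assoc mat_matrix_mul_vec)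
    then have "cross (rep g *v (C *v v)) w = 0" using fib[OF M] by simp
    \<comment> \<open>\<open>rep g\<close> sends both \<open>C *v v\<close> and \<open>v\<close> to
      the line of \<open>w\<close>; cancelling \<open>det (rep g)\<close> shows that
      \<open>C\<close> fixes the line of \<open>v\<close>.\<close>
    then have "cross (rep g *v (C *v v)) (rep g *v v) = 0"
      using cross_trans[OF nz(2)] fib[OF g] cross_commute_0 by blast
    then have "cross (C *v v) v = 0" using rep(1)[OF g] by (simp add: cross_mult)
    then obtain d where d: "C *v v = d *s v" using cross_eq_0_iff[OF nz(1)] by blast
    have "d \<noteq> 0" using invertible_mult_vec_nonzero[OF C(2) nz(1)] d by auto
    have "(*v) C ` P = range (\<lambda>k. (k * d) *s v)"
      unfolding P_def image_image using d by (simp add: vec.scale)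
    also have "\<dots> = P"
    proof
      show "P \<subseteq> range (\<lambda>k. (k * d) *s v)"
      proof
        fix x assume "x \<in> P"
        then obtain k where "x = k *s v" by (auto simp: P_def)
        then have "x = ((k / d) * d) *s v" using \<open>d \<noteq> 0\<close> by simp
        then show "x \<in> range (\<lambda>k. (k * d) *s v)" by blast
      qed
    qed (auto simp: P_def)
    finally have "PGL2_action h P = P" using action_pclass[OF sub] C by simp
    then have "h \<in> stabilizer PGL2 PGL2_action P" using h by (simp add: stabilizer_def)
    then show ?thesis using h(2) by (auto simp: l_coset_def)
  qed
  then show ?thesis using P F g by blast
qed

end
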